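(* Let $\mathcal X_1,\mathcal X_2,\mathcal X_3,\mathcal X_4$ be Hilbert spaces, set $\mathcal X:=\mathcal X_1\times\mathcal X_2\times\mathcal X_3\times\mathcal X_4$, and define $$\mathsf K:=\begin{bmatrix}\mathsf L&\mathsf A^\star&0&0\\ \mathsf A&0&-\mathsf B&0\\ 0&-\mathsf B^\star&\mathsf D&\mathsf P^\star\\ 0&0&\mathsf P&0\end{bmatrix}:\mathcal X\to\mathcal X^\star .$$ Assume that $\mathsf A\in\mathcal L(\mathcal X_1,\mathcal X_2^\star)$ is Fredholm, that $\mathsf P\in\mathcal L(\mathcal X_3,\mathcal X_4^\star)$, that $\mathsf D\in\mathcal L(\mathcal X_3,\mathcal X_3^\star)$ and $\mathsf P\mathsf D^{-1}\mathsf P^\star\in\mathcal L(\mathcal X_4,\mathcal X_4^\star)$ are isomorphisms, and that $\mathsf L\in\mathcal L(\mathcal X_1,\mathcal X_1^\star)$ and $\mathsf B\in\mathcal L(\mathcal X_3,\mathcal X_2^\star)$ are compact. Then $\mathsf K$ is Fredholm with $\operatorname{ind}(\mathsf K)=0$. When $\mathcal X_3=\mathcal X_4=\{0\}$, the same conclusion holds for the reduced operator $$\begin{bmatrix}\mathsf L&\mathsf A^\star\\ \mathsf A&0\end{bmatrix}:\mathcal X_1\times\mathcal X_2\to\mathcal X_1^\star\times\mathcal X_2^\star .$$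
   Context: $\mathcal L(Y,Z)$ denotes bounded linear operators from $Y$ to $Z$, $Z^\star$ the dual space of $Z$, and $T^\star$ the adjoint with respect to duality pairings, with Hilbert spaces identified with their biduals (so $\mathsf A^\star:\mathcal X_2\to\mathcal X_1^\star$, $\mathsf B^\star:\mathcal X_2\to\mathcal X_3^\star$, $\mathsf P^\star:\mathcal X_4\to\mathcal X_3^\star$). $\mathcal X^\star$ is identified with $\prod_i\mathcal X_i^\star$. A bounded operator is Fredholm if its kernel is finite-dimensional and its range is closed with finite codimension; $\operatorname{ind}=\dim\ker-\operatorname{codim}\operatorname{ran}$. *)

theory Defs
  imports "HOL-Analysis.Analysis"
begin

text \<open>
  The scalar field is a type of sort \<open>{real_normed_field, euclidean_space}\<close>.  Up to isometric
  isomorphism such a field is \<open>real\<close> or \<open>complex\<close>: if \<open>norm u = 1\<close> and \<open>u \<bullet> 1 = 0\<close>, then comparing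
  \<open>norm (1 + t u) * norm (1 - t u) = 1 + t^2\<close> with \<open>norm (1 - t^2 u^2)\<close> gives \<open>u^2 = -1\<close>, and a field
  contains at most two such \<open>u\<close>.  So real and complex Hilbert spaces are treated at once.
\<close>

definition scalar_cnj :: "'k::{real_normed_field, euclidean_space} \<Rightarrow> 'k"
  where "scalar_cnj c = of_real (2 * (c \<bullet> 1)) - c"

lemma scalar_cnj_real: "scalar_cnj (c :: real) = c"
  by (simp add: scalar_cnj_def)

lemma scalar_cnj_complex: "scalar_cnj (c :: complex) = cnj c"
  by (simp add: scalar_cnj_def complex_eq_iff inner_complex_def)

text \<open>
  \<open>ip\<close> is the scalar-valued inner product, linear in the first argument.  The class operation
  \<open>inner\<close> induces the same norm, so by polarisation it is the real part of \<open>ip\<close>.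
\<close>

locale hilbert_space = vector_space scale
  for scale :: "'k::{real_normed_field, euclidean_space} \<Rightarrow> 'a::{real_inner, banach} \<Rightarrow> 'a" +
  fixes ip :: "'a \<Rightarrow> 'a \<Rightarrow> 'k"
  assumes scale_of_real: "scale (of_real r) x = r *\<^sub>R x"
    and ip_add: "ip (x + y) z = ip x z + ip y z"
    and ip_scale: "ip (scale c x) y = c * ip x y"
    and ip_cnj: "ip y x = scalar_cnj (ip x y)"
    and ip_norm: "ip x x = of_real ((norm x)\<^sup>2)"

lemma hilbert_space_real:
  "hilbert_space scaleR (inner :: 'a::{real_inner, banach} \<Rightarrow> 'a \<Rightarrow> real)"
  by unfold_locales
    (simp_all add: algebra_simps scalar_cnj_real inner_commute power2_norm_eq_inner)

lemma hilbert_space_complex: "hilbert_space (*) (\<lambda>x y :: complex. x * cnj y)"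
  by unfold_locales
    (simp_all add: algebra_simps scaleR_conv_of_real scalar_cnj_complex complex_norm_square
      flip: of_real_power)

text \<open>
  For a complex space, \<open>'a \<Rightarrow>\<^sub>L 'k\<close> contains all bounded real-linear maps, so the dual space is a
  closed subspace of it, with the operator norm.
\<close>

definition dual :: "('k::{real_normed_field, euclidean_space} \<Rightarrow> 'a::real_normed_vector \<Rightarrow> 'a)
    \<Rightarrow> ('a \<Rightarrow>\<^sub>L 'k) set"
  where "dual s = {f. \<forall>c x. blinfun_apply f (s c x) = c * blinfun_apply f x}"

definition dual_scale :: "'k::{real_normed_field, euclidean_space}
    \<Rightarrow> ('a::real_normed_vector \<Rightarrow>\<^sub>L 'k) \<Rightarrow> ('a \<Rightarrow>\<^sub>L 'k)"
  where "dual_scale c f = blinfun_mult_right c o\<^sub>L f"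

definition prod_scale :: "('k \<Rightarrow> 'a \<Rightarrow> 'a) \<Rightarrow> ('k \<Rightarrow> 'b \<Rightarrow> 'b) \<Rightarrow> 'k \<Rightarrow> 'a \<times> 'b \<Rightarrow> 'a \<times> 'b"
  where "prod_scale s t c = map_prod (s c) (t c)"

lemma vector_space_dual_scale:
  "vector_space (dual_scale :: 'k::{real_normed_field, euclidean_space}
    \<Rightarrow> ('a::real_normed_vector \<Rightarrow>\<^sub>L 'k) \<Rightarrow> _)"
  by unfold_locales
    (auto intro!: blinfun_eqI simp: dual_scale_def plus_blinfun.rep_eq algebra_simps)

lemma vector_space_prod_scale:
  "vector_space s \<Longrightarrow> vector_space t \<Longrightarrow> vector_space (prod_scale s t)"
  by (simp add: vector_space_def prod_scale_def)

text \<open>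
  Operators run from a full type with scalar multiplication \<open>s\<close> to a subspace \<open>W\<close> (a product of
  dual spaces) of a type with scalar multiplication \<open>t\<close>.
\<close>

definition bounded_ops :: "('k \<Rightarrow> 'v \<Rightarrow> 'v) \<Rightarrow> ('k \<Rightarrow> 'w \<Rightarrow> 'w) \<Rightarrow> 'w set
    \<Rightarrow> ('v::real_normed_vector \<Rightarrow> 'w::real_normed_vector) set"
  where "bounded_ops s t W =
    {T. bounded_linear T \<and> (\<forall>c x. T (s c x) = t c (T x)) \<and> range T \<subseteq> W}"

definition compact_op :: "('k \<Rightarrow> 'v \<Rightarrow> 'v) \<Rightarrow> ('k \<Rightarrow> 'w \<Rightarrow> 'w) \<Rightarrow> 'w set
    \<Rightarrow> ('v::real_normed_vector \<Rightarrow> 'w::real_normed_vector) \<Rightarrow> bool"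
  where "compact_op s t W T \<longleftrightarrow> T \<in> bounded_ops s t W \<and> compact (closure (T ` cball 0 1))"

definition isomorphism_op :: "('k \<Rightarrow> 'v \<Rightarrow> 'v) \<Rightarrow> ('k \<Rightarrow> 'w \<Rightarrow> 'w) \<Rightarrow> 'w set
    \<Rightarrow> ('v::real_normed_vector \<Rightarrow> 'w::real_normed_vector) \<Rightarrow> bool"
  where "isomorphism_op s t W T \<longleftrightarrow>
    T \<in> bounded_ops s t W \<and> bij_betw T UNIV W \<and> (\<exists>C. \<forall>w\<in>W. norm (inv T w) \<le> C * norm w)"

definition finite_dimensional :: "('k::field \<Rightarrow> 'v::ab_group_add \<Rightarrow> 'v) \<Rightarrow> 'v set \<Rightarrow> bool"
  where "finite_dimensional s V \<longleftrightarrow> (\<exists>B. finite B \<and> V \<subseteq> module.span s B)"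

text \<open>
  The set \<open>B\<close> is mapped injectively onto a basis of the quotient space \<open>W / R\<close>; the independence
  clause is \<open>module.dependent\<close> read modulo \<open>R\<close>.
\<close>

definition quotient_basis :: "('k::field \<Rightarrow> 'w::ab_group_add \<Rightarrow> 'w) \<Rightarrow> 'w set \<Rightarrow> 'w set \<Rightarrow> 'w set \<Rightarrow> bool"
  where "quotient_basis t W R B \<longleftrightarrow>
    B \<subseteq> W \<and> (\<forall>b\<in>B. b \<notin> module.span t (R \<union> (B - {b}))) \<and> W \<subseteq> module.span t (R \<union> B)"

definition finite_codim :: "('k::field \<Rightarrow> 'w::ab_group_add \<Rightarrow> 'w) \<Rightarrow> 'w set \<Rightarrow> 'w set \<Rightarrow> bool"
  where "finite_codim t W R \<longleftrightarrow> (\<exists>B. finite B \<and> quotient_basis t W R B)"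

definition codim :: "('k::field \<Rightarrow> 'w::ab_group_add \<Rightarrow> 'w) \<Rightarrow> 'w set \<Rightarrow> 'w set \<Rightarrow> nat"
  where "codim t W R = card (SOME B. quotient_basis t W R B)"

definition ker :: "('v \<Rightarrow> 'w::zero) \<Rightarrow> 'v set"
  where "ker T = {x. T x = 0}"

definition fredholm :: "('k::field \<Rightarrow> 'v \<Rightarrow> 'v) \<Rightarrow> ('k \<Rightarrow> 'w \<Rightarrow> 'w) \<Rightarrow> 'w set
    \<Rightarrow> ('v::real_normed_vector \<Rightarrow> 'w::real_normed_vector) \<Rightarrow> bool"
  where "fredholm s t W T \<longleftrightarrow>
    T \<in> bounded_ops s t W \<and> finite_dimensional s (ker T) \<and>
    closed (range T) \<and> finite_codim t W (range T)"

definition fredholm_index :: "('k::field \<Rightarrow> 'v \<Rightarrow> 'v) \<Rightarrow> ('k \<Rightarrow> 'w \<Rightarrow> 'w) \<Rightarrow> 'w set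
    \<Rightarrow> ('v::ab_group_add \<Rightarrow> 'w::ab_group_add) \<Rightarrow> int"
  where "fredholm_index s t W T =
    int (vector_space.dim s (ker T)) - int (codim t W (range T))"

text \<open>
  The adjoint of \<open>T : Y \<rightarrow> Z\<^sup>*\<close> as a map \<open>Z \<rightarrow> Y\<^sup>*\<close>, the Hilbert space \<open>Z\<close> being identified with its
  bidual by evaluation: the pairing of \<open>T\<^sup>* z\<close> with \<open>y\<close> is the pairing of \<open>T y\<close> with \<open>z\<close>.
\<close>

definition adjoint_op :: "('y::real_normed_vector \<Rightarrow> ('z::real_normed_vector \<Rightarrow>\<^sub>L 'k::real_normed_vector))
    \<Rightarrow> 'z \<Rightarrow> ('y \<Rightarrow>\<^sub>L 'k)"
  where "adjoint_op T z = Blinfun (\<lambda>y. blinfun_apply (T y) z)"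

lemma adjoint_op_apply:
  assumes "bounded_linear T"
  shows "blinfun_apply (adjoint_op T z) y = blinfun_apply (T y) z"
proof -
  have "bounded_linear (\<lambda>y. blinfun_apply (T y) z)"
    using bounded_linear_compose[OF blinfun.bounded_linear_left assms] by (simp add: o_def)
  then show ?thesis
    by (simp add: adjoint_op_def bounded_linear_Blinfun_apply)
qed

definition block_op ::
  "('a \<Rightarrow> ('a \<Rightarrow>\<^sub>L 'k)) \<Rightarrow> ('a \<Rightarrow> ('b \<Rightarrow>\<^sub>L 'k)) \<Rightarrow> ('c \<Rightarrow> ('b \<Rightarrow>\<^sub>L 'k)) \<Rightarrow> ('c \<Rightarrow> ('c \<Rightarrow>\<^sub>L 'k)) \<Rightarrow> ('c \<Rightarrow> ('d \<Rightarrow>\<^sub>L 'k))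
    \<Rightarrow> 'a::real_normed_vector \<times> 'b::real_normed_vector \<times> 'c::real_normed_vector \<times> 'd::real_normed_vector
    \<Rightarrow> ('a \<Rightarrow>\<^sub>L 'k::real_normed_vector) \<times> ('b \<Rightarrow>\<^sub>L 'k) \<times> ('c \<Rightarrow>\<^sub>L 'k) \<times> ('d \<Rightarrow>\<^sub>L 'k)"
  where "block_op L A B D P = (\<lambda>(x1, x2, x3, x4).
    (L x1 + adjoint_op A x2,
     A x1 - B x3,
     - adjoint_op B x2 + D x3 + adjoint_op P x4,
     P x3))"

definition reduced_block_op ::
  "('a \<Rightarrow> ('a \<Rightarrow>\<^sub>L 'k)) \<Rightarrow> ('a \<Rightarrow> ('b \<Rightarrow>\<^sub>L 'k))
    \<Rightarrow> 'a::real_normed_vector \<times> 'b::real_normed_vector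
    \<Rightarrow> ('a \<Rightarrow>\<^sub>L 'k::real_normed_vector) \<times> ('b \<Rightarrow>\<^sub>L 'k)"
  where "reduced_block_op L A = (\<lambda>(x1, x2). (L x1 + adjoint_op A x2, A x1))"

end

(*
  An operator J + R between Hilbert spaces, with J bijective and R a norm limit of finite rank
  operators, is Fredholm of index 0: absorbing the small part of R into J leaves an isomorphism
  plus a finite rank operator, for which the claim is rank-nullity.  In a Hilbert space a compact
  operator and its adjoint are norm limits of finite rank operators, by orthogonal projection onto
  the span of a finite net.  So it suffices to make the principal part bijective.  For the block
  [0, A*; A, 0] this is achieved by adding on the diagonal the finite rank forms
  sum_e <x, e> <y, e> over orthonormal bases of ker A and ker A*, since by the closed range theorem
  ran A and ran A* are the annihilators of ker A* and ker A.  The block [D, P*; P, 0] is bijective by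
  its Schur complement P D^{-1} P*.
*)

theory Submission
  imports Defs
begin

section \<open>Codimension and finite rank perturbations of the identity\<close>

text \<open>A itself may have nonzero index, so a finite rank change of A alone need not make it
  bijective. In the off-diagonal block the corrections pair ker A with itself and the kernel of the
  adjoint with itself, so the two dimensions never have to match. The corrections are subtracted
  again in the perturbation, next to L, B and the adjoint of B. The scalars shape the rest. Dual
  spaces are sets inside types of bounded real-linear maps, so each operator carries a target set W,
  and surjectivity reads \<open>range J = W\<close>. Minimisation, orthogonality and completeness
  use the real \<open>inner\<close>; an identity of real parts is lifted to the scalars by testing
  it on all scalar multiples. \<open>codim\<close> picks a quotient basis by choice, so its value is
  usable only once all quotient bases are known to have the same size.\<close>

context vector_space
begin

text \<open>Makes \<open>codim\<close> well defined. Projecting along R onto the span of B turns B'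
  into an ordinary basis of that span, where dimension decides.\<close>

lemma quotient_basis_card:
  assumes R: "subspace R" and "finite B"
    and B: "quotient_basis scale W R B" and B': "quotient_basis scale W R B'"
  shows "card B' = card B"
proof -
  interpret vector_space_pair scale scale by unfold_locales
  have BW: "B \<subseteq> W" "B' \<subseteq> W" and WB: "W \<subseteq> span (R \<union> B)" "W \<subseteq> span (R \<union> B')"
    using B B' by (auto simp: quotient_basis_def)
  have indB: "b \<notin> span (R \<union> (B - {b}))" if "b \<in> B" for b
    using B that by (auto simp: quotient_basis_def)
  have indB': "b \<notin> span (R \<union> (B' - {b}))" if "b \<in> B'" for b
    using B' that by (auto simp: quotient_basis_def)
  obtain C where C: "C \<subseteq> R" "independent C" "R \<subseteq> span C"
    using maximal_independent_subset by blast
  \<comment> \<open>Independence modulo R becomes plain independence once a basis C of R is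
    adjoined; the elements of B are added one at a time.\<close>
  have "independent (C \<union> E)" if "E \<subseteq> B" for E
    using finite_subset[OF that \<open>finite B\<close>] that
  proof (induction E rule: finite_induct)
    case empty
    then show ?case using C by simp
  next
    case (insert b E)
    have "C \<union> E \<subseteq> R \<union> (B - {b})" using C insert by auto
    then have "b \<notin> span (C \<union> E)" using indB[of b] insert.prems span_mono by blast
    then show ?case using insert by (simp add: independent_insertI)
  qed
  then have ind: "independent (C \<union> B)" by blast
  have disj: "b \<notin> C" if "b \<in> B" for b
    using C(1) indB[OF that] span_base by blast
  \<comment> \<open>\<open>p\<close> projects \<open>span (R \<union> B)\<close> onto \<open>span B\<close> along \<open>R\<close>\<close>
  obtain p where lp: "Vector_Spaces.linear scale scale p"
    and p: "\<forall>x\<in>C \<union> B. p x = (if x \<in> B then x else 0)"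
    using linear_independent_extend[OF ind, of "\<lambda>x. if x \<in> B then x else 0"] by blast
  interpret p: Vector_Spaces.linear scale scale p by fact
  have p0: "p x = 0" if "x \<in> R" for x
    using p.eq_0_on_span[of C x] p disj C that by (metis UnI1 subsetD)
  have pB: "p x = x" if "x \<in> span B" for x
    using linear_eq_on_span[OF lp linear_id, of B x] p that by (simp add: id_def)
  have kerp: "x \<in> R" if x: "x \<in> span (R \<union> B)" "p x = 0" for x
  proof -
    obtain r v where "x = r + v" "r \<in> span R" "v \<in> span B"
      using x(1) unfolding span_Un by blast
    moreover have "span R = R" using R by simp
    ultimately show ?thesis using x(2) p0[of r] pB[of v] by (simp add: p.add)
  qed
  \<comment> \<open>A relation among the images lifts to a difference in the kernel of p, which
    inside span (R \<union> B) is R; that would be a dependence of B' modulo R.\<close>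
  have neq: "p b \<notin> p ` span (B' - {b})" if b: "b \<in> B'" for b
  proof
    assume "p b \<in> p ` span (B' - {b})"
    then obtain v where v: "v \<in> span (B' - {b})" "p (b - v) = 0" by (auto simp: p.diff)
    have "B' - {b} \<subseteq> span (R \<union> B)" using BW WB by blast
    then have "v \<in> span (R \<union> B)" using v(1) span_minimal subspace_span by blast
    moreover have "b \<in> span (R \<union> B)" using b BW WB by blast
    ultimately have "b - v \<in> R" using v(2) kerp span_diff by blast
    then have "b - v \<in> span (R \<union> (B' - {b}))" by (simp add: span_base)
    moreover have "v \<in> span (R \<union> (B' - {b}))"
      using v(1) span_mono[of "B' - {b}" "R \<union> (B' - {b})"] by blast
    ultimately have "b \<in> span (R \<union> (B' - {b}))"
      using span_add by fastforce
    then show False using indB' b by blast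
  qed
  have inj: "inj_on p B'"
  proof (rule inj_onI, rule ccontr)
    fix b c assume "b \<in> B'" "c \<in> B'" "p b = p c" "b \<noteq> c"
    then show False using neq[of b] span_base[of c "B' - {b}"] by auto
  qed
  have "independent (p ` B')"
    unfolding dependent_def
  proof
    assume "\<exists>a\<in>p ` B'. a \<in> span (p ` B' - {a})"
    then obtain b where b: "b \<in> B'" "p b \<in> span (p ` B' - {p b})" by blast
    have "p ` B' - {p b} \<subseteq> p ` (B' - {b})" by blast
    then have "p b \<in> span (p ` (B' - {b}))" using b(2) span_mono by blast
    then show False using neq[OF b(1)] by (simp add: p.span_image)
  qed
  moreover have "span (p ` B') = span B"
  proof
    have *: "p ` span (R \<union> B) \<subseteq> span B"
      by (smt (verit) image_subset_iff mem_Collect_eq p.add pB p0 span_Un span_eq_iff R add_0)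
    then show "span (p ` B') \<subseteq> span B"
      using BW(2) WB(1) by (intro span_minimal subspace_span) blast
    have "b \<in> span (p ` B')" if "b \<in> B" for b
    proof -
      have "p b \<in> p ` span (R \<union> B')" using that BW WB by blast
      then have "p b \<in> span (p ` R \<union> p ` B')" by (metis p.span_image image_Un)
      moreover have "p ` R \<union> p ` B' \<subseteq> insert 0 (p ` B')" using p0 by auto
      ultimately have "p b \<in> span (insert 0 (p ` B'))" using span_mono by blast
      then show ?thesis using pB[OF span_base[OF that]] by simp
    qed
    then show "span B \<subseteq> span (p ` B')" by (intro span_minimal subspace_span) blast
  qed
  moreover have "independent B" using ind independent_mono by blast
  ultimately have "card (p ` B') = card B"
    by (metis dim_eq_card)
  then show ?thesis using card_image[OF inj] by simp
qed

lemma codim_eq_card: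
  assumes "subspace R" "finite B" "quotient_basis scale W R B"
  shows "codim scale W R = card B"
  unfolding codim_def using assms by (metis quotient_basis_card someI)

text \<open>Rank-nullity localised: S is the identity modulo the finite-dimensional V = span F, so
  ker S lies in V, and a complement of S V in V is also one of range S in the whole space.\<close>

lemma identity_plus_finite_rank_index:
  assumes S: "Vector_Spaces.linear scale scale S" and "finite F"
    and SF: "\<And>x. S x - x \<in> span F"
  obtains C B where "finite C" "independent C" "span C = ker S"
    "finite B" "quotient_basis scale UNIV (range S) B" "card B = card C"
proof -
  interpret vector_space_pair scale scale by unfold_locales
  interpret S: Vector_Spaces.linear scale scale S by fact
  define V where "V = span F"
  have V: "subspace V" by (simp add: V_def)
  have SV: "S x \<in> V \<longleftrightarrow> x \<in> V" for x
    using SF[of x] V unfolding V_def[symmetric]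
    by (metis diff_add_cancel subspace_add subspace_diff diff_diff_eq2 add_diff_cancel_left')
  have kerV: "ker S \<subseteq> V"
    using SV subspace_0[OF V] by (force simp: ker_def)
  have fin: "finite E" if "independent E" "E \<subseteq> V" for E
    using independent_span_bound[OF \<open>finite F\<close>] that unfolding V_def by blast
  have kerS: "subspace (ker S)" unfolding ker_def by (rule S.subspace_kernel)
  obtain C where C: "C \<subseteq> ker S" "independent C" "ker S \<subseteq> span C"
    using maximal_independent_subset by blast
  have spanC: "span C = ker S"
    using C kerS by (meson span_minimal subset_antisym)
  \<comment> \<open>E - C spans a complement of ker S in V, on which S is therefore
    injective.\<close>
  obtain E where E: "C \<subseteq> E" "E \<subseteq> V" "independent E" "V \<subseteq> span E"
    using maximal_independent_subset_extend[of C V] C kerV by blast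
  have finE: "finite E" using fin E by blast
  obtain p where lp: "Vector_Spaces.linear scale scale p"
    and p: "\<forall>x\<in>E. p x = (if x \<in> C then 0 else x)"
    using linear_independent_extend[OF E(3), of "\<lambda>x. if x \<in> C then 0 else x"] by blast
  interpret p: Vector_Spaces.linear scale scale p by fact
  have pC: "p x = 0" if "x \<in> span C" for x
    using p.eq_0_on_span[of C x] p that E by (metis subsetD)
  have pD: "p x = x" if "x \<in> span (E - C)" for x
    using linear_eq_on_span[OF lp linear_id, of "E - C" x] p that by (simp add: id_def)
  have inj: "inj_on S (span (E - C))"
  proof (rule S.inj_on_iff_eq_0[THEN iffD2])
    show "\<forall>x\<in>span (E - C). S x = 0 \<longrightarrow> x = 0"
      using pC pD spanC unfolding ker_def by fastforce
  qed (rule subspace_span)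
  have SD: "independent (S ` (E - C))"
    using S.independent_injective_image[OF independent_mono[OF E(3)] inj] by blast
  have SDV: "S ` (E - C) \<subseteq> V" using E SV by auto
  \<comment> \<open>G and E are both bases of V, so G exceeds the image of E - C by exactly as many
    elements as C has: kernel and cokernel dimensions meet here.\<close>
  obtain G where G: "S ` (E - C) \<subseteq> G" "G \<subseteq> V" "independent G" "V \<subseteq> span G"
    using maximal_independent_subset_extend[OF SDV SD] by blast
  have finG: "finite G" using fin G by blast
  have "card G = card E"
    using basis_card_eq_dim[OF G(2,4,3)] basis_card_eq_dim[OF E(2,4,3)] by simp
  moreover have "card (S ` (E - C)) = card E - card C"
    using inj_on_subset[OF inj span_superset]
    by (metis card_image card_Diff_subset E(1) finE finite_subset)
  moreover have "card C \<le> card E" using E(1) finE by (rule card_mono[rotated])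
  ultimately have card: "card (G - S ` (E - C)) = card C"
    using G(1) finG by (simp add: card_Diff_subset finite_subset)
  have SspanE: "S x \<in> span (S ` (E - C))" if "x \<in> V" for x
  proof -
    have "S ` E \<subseteq> insert 0 (S ` (E - C))" using C(1) by (auto simp: ker_def)
    moreover have "S x \<in> span (S ` E)" using that E(4) by (auto simp: S.span_image)
    ultimately show ?thesis using span_mono span_insert_0 by blast
  qed
  have "quotient_basis scale UNIV (range S) (G - S ` (E - C))"
    unfolding quotient_basis_def
  proof (intro conjI ballI)
    show "G - S ` (E - C) \<subseteq> UNIV" by simp
  next
    fix b assume b: "b \<in> G - S ` (E - C)"
    show "b \<notin> span (range S \<union> (G - S ` (E - C) - {b}))" (is "b \<notin> span (_ \<union> ?G)")
    proof
      assume "b \<in> span (range S \<union> ?G)"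
      moreover have "span (range S) = range S"
        by (simp add: S.subspace_image)
      ultimately obtain x v where x: "b = S x + v" "v \<in> span ?G"
        by (auto simp: span_Un)
      have "?G \<subseteq> V" using G by auto
      then have "v \<in> V" using x V span_minimal by blast
      \<comment> \<open>Since S x lies in V, so does x; only then is S x a combination of the images
        of E - C, against the independence of G.\<close>
      then have "S x \<in> V" using x b G V by (metis DiffD1 add_diff_cancel_right' subset_iff subspace_diff)
      then have "S x \<in> span (S ` (E - C))" using SV SspanE by blast
      then have "b \<in> span (S ` (E - C) \<union> ?G)" using x by (auto simp: span_Un)
      moreover have "S ` (E - C) \<union> ?G \<subseteq> G - {b}" using G b by auto
      ultimately have "b \<in> span (G - {b})" using span_mono by blast
      then show False using G(3) b by (auto simp: dependent_def)
    qed
  next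
    show "UNIV \<subseteq> span (range S \<union> (G - S ` (E - C)))"
    proof
      fix x
      \<comment> \<open>x = S x - (S x - x) exhibits the whole space as range S + V.\<close>
      have "S x - x \<in> span G" using SF G(4) by (auto simp: V_def)
      moreover have "G \<subseteq> range S \<union> (G - S ` (E - C))" by auto
      ultimately have "S x - x \<in> span (range S \<union> (G - S ` (E - C)))" using span_mono by blast
      moreover have "S x \<in> span (range S \<union> (G - S ` (E - C)))" by (simp add: span_base)
      ultimately show "x \<in> span (range S \<union> (G - S ` (E - C)))"
        using span_diff by fastforce
    qed
  qed
  then show ?thesis
    using that[of C "G - S ` (E - C)"] C(2) spanC card finG finite_subset[OF E(1) finE] by auto
qed

end

text \<open>Used with the isomorphism J, to move a complement of range S to one of its image in
  W.\<close>

lemma (in Vector_Spaces.linear) quotient_basis_image: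
  assumes "inj f" and "quotient_basis s1 UNIV R B"
  shows "quotient_basis s2 (range f) (f ` R) (f ` B)"
  unfolding quotient_basis_def
proof (intro conjI ballI)
  have *: "\<forall>b\<in>B. b \<notin> vs1.span (R \<union> (B - {b}))" "UNIV \<subseteq> vs1.span (R \<union> B)"
    using assms(2) by (auto simp: quotient_basis_def)
  show "range f \<subseteq> vs2.span (f ` R \<union> f ` B)"
    using * by (auto simp: span_image image_Un[symmetric])
  fix b assume "b \<in> f ` B"
  then obtain c where c: "b = f c" "c \<in> B" by blast
  have "f ` B - {b} = f ` (B - {c})" using c \<open>inj f\<close> by (auto simp: inj_def)
  then have "vs2.span (f ` R \<union> (f ` B - {b})) = f ` vs1.span (R \<union> (B - {c}))"
    by (simp add: span_image image_Un[symmetric])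
  then show "b \<notin> vs2.span (f ` R \<union> (f ` B - {b}))"
    using * c \<open>inj f\<close> by (auto simp: inj_image_mem_iff)
qed auto

section \<open>Riesz representation and open mapping\<close>

text \<open>Direct method: if y represents g, then \<phi> x = |x - y|^2 - |y|^2, so the representer
  is the minimiser of \<phi>. Linearity of g is asked on R only: R = UNIV yields Riesz, and g =
  \<open>inner _ z\<close> the orthogonal projection of z.\<close>

lemma closed_subspace_riesz:
  fixes g :: "'a::{real_inner, banach} \<Rightarrow> real"
  assumes R: "subspace R" "closed R"
    and g_add: "\<And>x y. x \<in> R \<Longrightarrow> y \<in> R \<Longrightarrow> g (x + y) = g x + g y"
    and g_scale: "\<And>r x. x \<in> R \<Longrightarrow> g (r *\<^sub>R x) = r * g x"
    and g_bound: "\<And>x. x \<in> R \<Longrightarrow> \<bar>g x\<bar> \<le> M * norm x"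
  obtains y where "y \<in> R" "\<And>x. x \<in> R \<Longrightarrow> g x = inner x y"
proof -
  define \<phi> where "\<phi> x = (norm x)\<^sup>2 - 2 * g x" for x
  define m where "m = Inf (\<phi> ` R)"
  have g0: "0 \<in> R" "R \<noteq> {}" using R subspace_0 by auto
  have bound: "- M\<^sup>2 \<le> \<phi> x" if "x \<in> R" for x
  proof -
    have "0 \<le> (norm x - M)\<^sup>2" by simp
    then show ?thesis
      using g_bound[OF that] by (simp add: \<phi>_def power2_eq_square algebra_simps)
  qed
  then have bdd: "bdd_below (\<phi> ` R)" by (rule bdd_belowI2)
  have m_le: "m \<le> \<phi> x" if "x \<in> R" for x
    unfolding m_def using bdd that by (auto intro: cInf_lower)
  have "\<exists>x\<in>R. \<phi> x < m + inverse (real (Suc n))" for n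
    using cInf_lessD[of "\<phi> ` R" "m + inverse (real (Suc n))"] g0 by (auto simp: m_def)
  then obtain u where u: "u n \<in> R" "\<phi> (u n) < m + inverse (real (Suc n))" for n
    by metis
  have g_diff: "g (x - y) = g x - g y" if "x \<in> R" "y \<in> R" for x y
    using g_add[of x "- y"] g_scale[of y "-1"] that R(1) by (simp add: subspace_neg)
  \<comment> \<open>Parallelogram law: the midpoint stays in R and has value at least m, so
    near-minimisers are close to each other.\<close>
  have mid: "(norm (x - y))\<^sup>2 \<le> 2 * \<phi> x + 2 * \<phi> y - 4 * m" if "x \<in> R" "y \<in> R" for x y
  proof -
    have *: "(1/2) *\<^sub>R (x + y) \<in> R" using that R(1) by (simp add: subspace_add subspace_scale)
    have "g ((1/2) *\<^sub>R (x + y)) = (g x + g y) / 2"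
      using that R(1) by (simp add: g_scale g_add subspace_add)
    then have "4 * \<phi> ((1/2) *\<^sub>R (x + y)) = (norm (x + y))\<^sup>2 - 4 * g x - 4 * g y"
      by (simp add: \<phi>_def power2_eq_square)
    moreover have "(norm (x + y))\<^sup>2 + (norm (x - y))\<^sup>2 = 2 * (norm x)\<^sup>2 + 2 * (norm y)\<^sup>2"
      by (simp add: power2_norm_eq_inner algebra_simps inner_commute)
    ultimately show ?thesis using m_le[OF *] by (simp add: \<phi>_def)
  qed
  have "Cauchy u"
  proof (rule metric_CauchyI)
    fix e :: real assume "e > 0"
    \<comment> \<open>Two values within 1/(N+1) of m give a squared distance below 4/(N+1).\<close>
    then obtain N where N: "inverse (real (Suc N)) < e\<^sup>2 / 4"
      using reals_Archimedean[of "e\<^sup>2 / 4"] by auto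
    have "dist (u i) (u j) < e" if "i \<ge> N" "j \<ge> N" for i j
    proof -
      have "inverse (real (Suc i)) \<le> inverse (real (Suc N))" "inverse (real (Suc j)) \<le> inverse (real (Suc N))"
        using that by (simp_all add: le_imp_inverse_le)
      then have "(norm (u i - u j))\<^sup>2 < e\<^sup>2"
        using mid[OF u(1) u(1), of i j] u(2)[of i] u(2)[of j] N by linarith
      then show ?thesis
        using \<open>e > 0\<close> power_less_imp_less_base[of "norm (u i - u j)" 2 e] by (simp add: dist_norm)
    qed
    then show "\<exists>N. \<forall>i\<ge>N. \<forall>j\<ge>N. dist (u i) (u j) < e" by blast
  qed
  then obtain y where y: "u \<longlonglongrightarrow> y" by (auto simp: convergent_eq_Cauchy[symmetric])
  have yR: "y \<in> R" using closed_sequentially[OF R(2)] u(1) y by blast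
  have "(\<lambda>n. g (u n) - g y) \<longlonglongrightarrow> 0"
  proof (rule Lim_null_comparison)
    show "\<forall>\<^sub>F n in sequentially. norm (g (u n) - g y) \<le> M * norm (u n - y)"
      using g_bound[of "u _ - y"] R(1) u(1) yR g_diff[of "u _" y]
      by (simp add: subspace_diff)
    show "(\<lambda>n. M * norm (u n - y)) \<longlonglongrightarrow> 0"
      using tendsto_mult_right_zero tendsto_norm_zero LIM_zero y by blast
  qed
  then have "(\<lambda>n. \<phi> (u n)) \<longlonglongrightarrow> \<phi> y"
    unfolding \<phi>_def using y LIM_zero_cancel by (intro tendsto_intros) auto
  moreover have "(\<lambda>n. m + inverse (real (Suc n))) \<longlonglongrightarrow> m"
    using tendsto_add[OF tendsto_const LIMSEQ_inverse_real_of_nat, of m] by simp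
  ultimately have "\<phi> y \<le> m"
    by (rule LIMSEQ_le) (use u(2) less_imp_le in blast)
  have "g x = inner x y" if x: "x \<in> R" for x
  proof (rule ccontr)
    assume neq: "g x \<noteq> inner x y"
    define d where "d = g x - inner x y"
    have "d \<noteq> 0" "x \<noteq> 0"
      using neq g_scale[OF x, of 0] g_scale[OF g0(1), of 0] by (auto simp: d_def)
    \<comment> \<open>The minimiser of the quadratic - 2 t d + t^2 |x|^2.\<close>
    define t where "t = d / (norm x)\<^sup>2"
    have tx: "t *\<^sub>R x \<in> R" using x R(1) by (simp add: subspace_scale)
    have "\<phi> (y + t *\<^sub>R x) = (norm (y + t *\<^sub>R x))\<^sup>2 - 2 * g y - 2 * (t * g x)"
      using g_add[OF yR tx] g_scale[OF x] by (simp add: \<phi>_def)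
    also have "(norm (y + t *\<^sub>R x))\<^sup>2 = (norm y)\<^sup>2 + 2 * t * inner x y + t\<^sup>2 * (norm x)\<^sup>2"
      by (simp add: power2_norm_eq_inner inner_simps inner_commute)
        (simp add: power2_eq_square algebra_simps)
    finally have "\<phi> (y + t *\<^sub>R x) = \<phi> y - 2 * t * d + t\<^sup>2 * (norm x)\<^sup>2"
      by (simp add: \<phi>_def d_def algebra_simps)
    also have "\<dots> = \<phi> y - d\<^sup>2 / (norm x)\<^sup>2"
      using \<open>x \<noteq> 0\<close> by (simp add: t_def field_simps power2_eq_square)
    also have "\<dots> < \<phi> y" using \<open>x \<noteq> 0\<close> \<open>d \<noteq> 0\<close> by simp
    finally show False
      using m_le[of "y + t *\<^sub>R x"] \<open>\<phi> y \<le> m\<close> R(1) yR tx by (simp add: subspace_add)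
  qed
  with yR show thesis using that by blast
qed

text \<open>Baire is applied inside range T, complete because closed. The constant serves later both
  to bound inverses and to bound a functional induced on a range.\<close>

lemma closed_range_open_mapping:
  fixes T :: "'a::banach \<Rightarrow> 'b::banach"
  assumes T: "bounded_linear T" and cl: "closed (range T)"
  obtains C where "C > 0" "\<And>y. y \<in> range T \<Longrightarrow> \<exists>x. T x = y \<and> norm x \<le> C * norm y"
proof -
  interpret T: bounded_linear T by fact
  define R where "R = range T"
  have R: "subspace R" unfolding R_def
    by (intro linear_subspace_image T.linear_axioms subspace_UNIV)
  let ?X = "top_of_set R"
  define F where "F n = closure (T ` cball 0 (real n))" for n :: nat
  have FR: "F n \<subseteq> R" for n
    unfolding F_def R_def by (rule closure_minimal) (use cl in auto)
  have "R \<subseteq> (\<Union>n. F n)"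
  proof
    fix y assume "y \<in> R"
    then obtain x where "y = T x" by (auto simp: R_def)
    moreover obtain n where "norm x \<le> real n" using real_arch_simple by blast
    ultimately show "y \<in> (\<Union>n. F n)"
      unfolding F_def using closure_subset by fastforce
  qed
  then have UF: "(\<Union>n. F n) = R" using FR by blast
  have "\<exists>n. ?X interior_of (F n) \<noteq> {}"
  proof (rule ccontr)
    assume *: "\<nexists>n. ?X interior_of (F n) \<noteq> {}"
    have "completely_metrizable_space ?X"
      using cl by (simp add: R_def completely_metrizable_space_closedin completely_metrizable_space_euclidean)
    then have "?X interior_of (\<Union> (range F)) = {}"
    proof (intro Baire_category_alt)
      fix S assume "S \<in> range F"
      then show "closedin ?X S \<and> ?X interior_of S = {}"
        using * FR by (auto simp: F_def closed_subset)
    qed auto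
    then show False
      using UF interior_of_topspace[of ?X] subspace_0[OF R] by auto
  qed
  then obtain n y0 where "y0 \<in> ?X interior_of (F n)" by blast
  then obtain U where U: "openin ?X U" "y0 \<in> U" "U \<subseteq> F n" by (auto simp: interior_of_def)
  then obtain r where r: "r > 0" "\<And>y. y \<in> R \<Longrightarrow> dist y y0 < r \<Longrightarrow> y \<in> F n"
    unfolding openin_euclidean_subtopology_iff by blast
  have y0: "y0 \<in> F n" "y0 \<in> R" using U FR by blast+
  \<comment> \<open>Subtracting approximants at y0 + y and at y0 recentres the ball at 0; each is
    within d/2, and the preimage bound doubles to 2 n.\<close>
  have near: "\<exists>x. norm x \<le> 2 * real n \<and> norm (T x - y) < d" if "y \<in> R" "norm y < r" "d > 0" for y d
  proof -
    have "y0 + y \<in> F n" using r(2)[of "y0 + y"] that y0 R by (simp add: subspace_add dist_norm)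
    then obtain x1 where x1: "norm x1 \<le> n" "dist (T x1) (y0 + y) < d / 2"
      unfolding F_def closure_approachable using \<open>d > 0\<close> by (auto dest!: spec[of _ "d/2"])
    obtain x2 where x2: "norm x2 \<le> n" "dist (T x2) y0 < d / 2"
      using y0 unfolding F_def closure_approachable using \<open>d > 0\<close> by (auto dest!: spec[of _ "d/2"])
    have "T (x1 - x2) - y = (T x1 - (y0 + y)) - (T x2 - y0)" by (simp add: T.diff)
    then have "norm (T (x1 - x2) - y) < d"
      using x1(2) x2(2) norm_triangle_ineq4[of "T x1 - (y0 + y)" "T x2 - y0"]
      unfolding dist_norm \<open>T (x1 - x2) - y = _\<close> by linarith
    moreover have "norm (x1 - x2) \<le> 2 * real n"
      using x1(1) x2(1) norm_triangle_ineq4[of x1 x2] by linarith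
    ultimately show ?thesis by blast
  qed
  \<comment> \<open>Scaling y to norm r/2 and back multiplies the bound 2 n by 2 |y| / r.\<close>
  define K where "K = 4 * real n / r"
  have K: "K \<ge> 0" using r by (simp add: K_def)
  have half: "\<exists>x. norm x \<le> K * norm y \<and> norm (y - T x) \<le> norm y / 2" if y: "y \<in> R" for y
  proof (cases "y = 0")
    case False
    define c where "c = r / (2 * norm y)"
    have c: "c > 0" using False r by (simp add: c_def)
    have "norm (c *\<^sub>R y) < r" using False r by (simp add: c_def)
    moreover have "c *\<^sub>R y \<in> R" using y R by (simp add: subspace_scale)
    moreover have "c * norm y / 2 > 0" using c False by simp
    ultimately obtain x where x: "norm x \<le> 2 * real n" "norm (T x - c *\<^sub>R y) < c * norm y / 2"
      using near by blast
    have "norm (T x - c *\<^sub>R y) = c * norm (y - T (x /\<^sub>R c))"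
    proof -
      have "T x - c *\<^sub>R y = - (c *\<^sub>R (y - T (x /\<^sub>R c)))"
        using c by (simp add: T.scale algebra_simps)
      then show ?thesis using c by (metis norm_minus_cancel norm_scaleR abs_of_pos)
    qed
    then have "norm (y - T (x /\<^sub>R c)) \<le> norm y / 2" using x(2) c by simp
    moreover have "norm (x /\<^sub>R c) \<le> K * norm y"
    proof -
      have "norm (x /\<^sub>R c) = norm x / c" using c by (simp add: divide_inverse mult.commute)
      also have "\<dots> \<le> 2 * real n / c" using x(1) c by (simp add: divide_right_mono)
      also have "\<dots> = K * norm y" using False r by (simp add: c_def K_def field_simps)
      finally show ?thesis .
    qed
    ultimately show ?thesis by blast
  qed (auto intro!: exI[of _ 0])
  then obtain h where h: "\<And>y. y \<in> R \<Longrightarrow> norm (h y) \<le> K * norm y"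
    "\<And>y. y \<in> R \<Longrightarrow> norm (y - T (h y)) \<le> norm y / 2"
    by metis
  \<comment> \<open>The geometric series of halved residuals gives 2 K; the extra 1 keeps the
    constant positive when K = 0.\<close>
  have "\<exists>x. T x = y \<and> norm x \<le> (2 * K + 1) * norm y" if y: "y \<in> R" for y
  proof -
    \<comment> \<open>The residual after k corrections; the partial sums of T (h (z k)) telescope to
      y - z k.\<close>
    define z where "z k = ((\<lambda>v. v - T (h v)) ^^ k) y" for k
    have z0: "z 0 = y" and zS: "z (Suc k) = z k - T (h (z k))" for k by (simp_all add: z_def)
    have zR: "z k \<in> R" for k
      by (induction k) (use y R in \<open>auto simp: z0 zS R_def subspace_diff\<close>)
    have zn: "norm (z k) \<le> norm y * (1/2) ^ k" for k
    proof (induction k)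
      case (Suc k)
      then show ?case using h(2)[OF zR, of k] by (simp add: zS)
    qed (simp add: z0)
    have hn: "norm (h (z k)) \<le> K * norm y * (1/2) ^ k" for k
      using order_trans[OF h(1)[OF zR] mult_left_mono[OF zn K]] by (simp add: mult.assoc)
    have geo: "summable (\<lambda>k. K * norm y * (1/2::real) ^ k)" by (intro summable_mult) simp
    have sm: "summable (\<lambda>k. norm (h (z k)))"
      by (rule summable_comparison_test[OF _ geo]) (use hn in auto)
    define x where "x = (\<Sum>k. h (z k))"
    have "norm x \<le> (\<Sum>k. K * norm y * (1/2::real) ^ k)"
      unfolding x_def using summable_norm[OF sm] suminf_le[OF hn sm geo] by linarith
    also have "\<dots> = K * norm y * 2"
      using suminf_mult[of "\<lambda>k. (1/2::real) ^ k" "K * norm y"] by (simp add: suminf_geometric)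
    finally have nx: "norm x \<le> 2 * K * norm y" by (simp add: mult_ac)
    have "(\<lambda>k. T (h (z k))) sums T x"
      unfolding x_def by (intro T.sums summable_sums summable_norm_cancel[OF sm])
    moreover have "(\<Sum>i<k. T (h (z i))) = y - z k" for k
      by (induction k) (simp_all add: z0 zS)
    ultimately have "(\<lambda>k. y - z k) \<longlonglongrightarrow> T x" by (simp add: sums_def)
    moreover have "z \<longlonglongrightarrow> 0"
    proof (rule Lim_null_comparison)
      show "\<forall>\<^sub>F k in sequentially. norm (z k) \<le> norm y * (1/2) ^ k" using zn by simp
      show "(\<lambda>k. norm y * (1/2) ^ k) \<longlonglongrightarrow> 0"
        by (intro tendsto_mult_right_zero LIMSEQ_realpow_zero) auto
    qed
    then have "(\<lambda>k. y - z k) \<longlonglongrightarrow> y" using tendsto_diff[OF tendsto_const, of z 0 _ y] by simp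
    ultimately have "T x = y" using LIMSEQ_unique by blast
    moreover have "norm x \<le> (2 * K + 1) * norm y"
      using nx norm_ge_zero[of y] by (simp add: algebra_simps add_increasing2 del: norm_ge_zero)
    ultimately show ?thesis by blast
  qed
  then show thesis using that[of "2 * K + 1"] K by (auto simp: R_def)
qed

section \<open>Hilbert spaces over the scalar field\<close>

text \<open>\<open>u \<bullet> 1\<close> is the real part, and c = inverse u would make it 1. This
  lifts identities of real parts to identities of scalars.\<close>

lemma scalar_eq_0_if_inner_one:
  fixes u :: "'k::{real_normed_field, euclidean_space}"
  assumes "\<And>c. (c * u) \<bullet> 1 = 0"
  shows "u = 0"
proof (rule ccontr)
  assume "u \<noteq> 0"
  then have "(inverse u * u) \<bullet> 1 = 1" by (simp flip: power2_norm_eq_inner)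
  then show False using assms by simp
qed

lemma scalar_cnj_add: "scalar_cnj (a + b) = scalar_cnj a + scalar_cnj b"
  by (simp add: scalar_cnj_def inner_add_left algebra_simps)

lemma scalar_cnj_of_real_mult: "scalar_cnj (of_real r * a) = of_real r * scalar_cnj a"
proof -
  have "(of_real r * a) \<bullet> 1 = r * (a \<bullet> 1)" by (metis inner_scaleR_left scaleR_conv_of_real)
  then show ?thesis by (simp add: scalar_cnj_def algebra_simps)
qed

lemma scalar_cnj_0 [simp]: "scalar_cnj 0 = 0"
  by (simp add: scalar_cnj_def)

lemma inner_one_scalar_cnj: "scalar_cnj c \<bullet> 1 = c \<bullet> 1"
proof -
  have "(of_real r :: 'a) \<bullet> 1 = r" for r
    by (simp add: of_real_def power2_norm_eq_inner[symmetric])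
  from this[of "2 * (c \<bullet> 1)"] show ?thesis
    by (simp add: scalar_cnj_def inner_diff_left del: of_real_mult)
qed

lemma norm_scalar_cnj_le: "norm (scalar_cnj c) \<le> 3 * norm c"
proof -
  have "\<bar>c \<bullet> 1\<bar> \<le> norm c" using Cauchy_Schwarz_ineq2[of c 1] by simp
  moreover have "norm (scalar_cnj c) \<le> norm (of_real (2 * (c \<bullet> 1)) :: 'a) + norm c"
    unfolding scalar_cnj_def by (rule norm_triangle_ineq4)
  ultimately show ?thesis by simp
qed

context hilbert_space
begin

lemma ip_add_right: "ip x (y + z) = ip x y + ip x z"
  by (metis ip_add ip_cnj scalar_cnj_add)

lemma ip_scaleR: "ip (r *\<^sub>R x) y = r *\<^sub>R ip x y"
  by (simp add: ip_scale scale_of_real[symmetric] scaleR_conv_of_real)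

lemma ip_zero [simp]: "ip 0 y = 0" "ip y 0 = 0"
  using ip_scaleR[of 0 0 y] ip_cnj[of y 0] by auto

lemma ip_minus: "ip (- x) y = - ip x y"
  using ip_scaleR[of "-1" x y] by simp

lemma ip_diff: "ip (x - y) z = ip x z - ip y z"
  using ip_add[of x "- y" z] by (simp add: ip_minus)

lemma ip_sum: "ip (sum f A) y = (\<Sum>i\<in>A. ip (f i) y)"
  by (induction A rule: infinite_finite_induct) (simp_all add: ip_add)

lemma ip_inner_one: "ip x y \<bullet> 1 = inner x y"
proof -
  have sq: "ip x x \<bullet> 1 = (norm x)\<^sup>2" for x
    by (simp add: ip_norm of_real_def power2_norm_eq_inner[symmetric])
  have "ip (x + y) (x + y) \<bullet> 1 = ip x x \<bullet> 1 + ip y y \<bullet> 1 + 2 * (ip x y \<bullet> 1)"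
    using inner_one_scalar_cnj[of "ip x y"] by (simp add: ip_add ip_add_right inner_add_left flip: ip_cnj)
  moreover have "(norm (x + y))\<^sup>2 = (norm x)\<^sup>2 + (norm y)\<^sup>2 + 2 * inner x y"
    by (simp add: power2_norm_eq_inner inner_add_left inner_add_right inner_commute)
  ultimately show ?thesis by (simp add: sq)
qed

lemma ip_self_eq_0: "ip x x = 0 \<Longrightarrow> x = 0"
  by (simp add: ip_norm)

lemma ip_eq_0_commute: "ip x y = 0 \<Longrightarrow> ip y x = 0"
  using ip_cnj[of y x] by simp

text \<open>The locale does not postulate that scalar multiplication is bounded; it follows by
  evaluating \<open>ip\<close> at the scaled vector.\<close>

lemma norm_scale_le: "norm (scale c x) \<le> 2 * norm c * norm x"
proof -
  have "ip (scale c x) (scale c x) = c * scalar_cnj (ip (scale c x) x)"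
    by (simp only: ip_scale ip_cnj[of x "scale c x"])
  also have "\<dots> = c * scalar_cnj (of_real ((norm x)\<^sup>2) * c)"
    by (simp add: ip_scale ip_norm mult.commute)
  also have "\<dots> = of_real ((norm x)\<^sup>2) * (c * scalar_cnj c)"
    unfolding scalar_cnj_of_real_mult by (simp add: mult_ac)
  finally have "norm (ip (scale c x) (scale c x)) = (norm x)\<^sup>2 * (norm c * norm (scalar_cnj c))"
    by (simp add: norm_mult norm_power)
  then have "(norm (scale c x))\<^sup>2 = (norm x)\<^sup>2 * (norm c * norm (scalar_cnj c))"
    by (simp add: ip_norm norm_power)
  \<comment> \<open>The factor 3 for conjugation is relaxed to 4 to make the bound a perfect
    square.\<close>
  also have "\<dots> \<le> (norm x)\<^sup>2 * (norm c * (4 * norm c))"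
    using order_trans[OF norm_scalar_cnj_le[of c], of "4 * norm c"] by (intro mult_left_mono) auto
  also have "\<dots> = (2 * norm c * norm x)\<^sup>2" by (simp add: power2_eq_square)
  finally show ?thesis by (rule power2_le_imp_le) simp
qed

text \<open>A scalar of norm 1 rotates \<open>ip x y\<close> to its norm, where the real
  Cauchy-Schwarz inequality applies; the 2 comes from \<open>norm_scale_le\<close>.\<close>

lemma norm_ip_le: "norm (ip x y) \<le> 2 * norm x * norm y"
proof (cases "ip x y = 0")
  case False
  define c where "c = inverse (ip x y) * of_real (norm (ip x y))"
  have "norm c = 1" using False by (simp add: c_def norm_mult norm_inverse)
  have "c * ip x y = of_real (norm (ip x y))" using False by (simp add: c_def)
  then have "norm (ip x y) = ip (scale c x) y \<bullet> 1"
    by (simp add: ip_scale of_real_def power2_norm_eq_inner[symmetric])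
  also have "\<dots> \<le> norm (scale c x) * norm y" by (simp add: ip_inner_one norm_cauchy_schwarz)
  also have "\<dots> \<le> (2 * norm x) * norm y"
    using norm_scale_le[of c x] \<open>norm c = 1\<close> by (intro mult_right_mono) auto
  finally show ?thesis .
qed simp

lemma bounded_linear_ip: "bounded_linear (\<lambda>x. ip x y)"
  by (rule bounded_linear_intro[of _ "2 * norm y"])
    (use norm_ip_le in \<open>auto simp: ip_add ip_scaleR mult_ac\<close>)

definition ip_functional :: "'a \<Rightarrow> 'a \<Rightarrow>\<^sub>L 'k"
  where "ip_functional y = Blinfun (\<lambda>x. ip x y)"

lemma ip_functional_apply [simp]: "blinfun_apply (ip_functional y) x = ip x y"
  by (simp add: ip_functional_def bounded_linear_Blinfun_apply bounded_linear_ip)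

lemma ip_functional_dual: "ip_functional y \<in> dual scale"
  by (simp add: dual_def ip_scale)

text \<open>The real theorem represents the real part of f; agreement of real parts at all multiples
  of x forces agreement of the scalars.\<close>

lemma riesz:
  assumes f: "f \<in> dual scale"
  obtains y where "f = ip_functional y"
proof -
  have "\<bar>blinfun_apply f x \<bullet> 1\<bar> \<le> norm f * norm x" for x
    using Cauchy_Schwarz_ineq2[of "blinfun_apply f x" 1] norm_blinfun[of f x] by simp
  then obtain y where y: "\<And>x. blinfun_apply f x \<bullet> 1 = inner x y"
    using closed_subspace_riesz[of UNIV "\<lambda>x. blinfun_apply f x \<bullet> 1" "norm f"]
    by (auto simp: blinfun.add_right blinfun.scaleR_right inner_add_left)
  have "blinfun_apply f x - ip x y = 0" for x
  proof (rule scalar_eq_0_if_inner_one)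
    fix c
    have "blinfun_apply f (scale c x) \<bullet> 1 = ip (scale c x) y \<bullet> 1" by (simp only: y ip_inner_one)
    then show "(c * (blinfun_apply f x - ip x y)) \<bullet> 1 = 0"
      using f by (simp add: dual_def ip_scale algebra_simps inner_diff_left)
  qed
  then have "f = ip_functional y" by (intro blinfun_eqI) simp
  then show thesis by (rule that)
qed

section \<open>Orthonormal sets, projections and Gram-Schmidt\<close>

definition orthonormal :: "'a set \<Rightarrow> bool"
  where "orthonormal E \<longleftrightarrow> finite E \<and> (\<forall>x\<in>E. \<forall>y\<in>E. ip x y = (if x = y then 1 else 0))"

definition proj :: "'a set \<Rightarrow> 'a \<Rightarrow> 'a"
  where "proj E x = (\<Sum>e\<in>E. scale (ip x e) e)"

lemma proj_in_span: "proj E x \<in> span E"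
  unfolding proj_def by (intro span_sum span_scale span_base)

lemma proj_add: "proj E (x + y) = proj E x + proj E y"
  by (simp add: proj_def ip_add scale_left_distrib sum.distrib)

lemma proj_scale: "proj E (scale c x) = scale c (proj E x)"
  by (simp add: proj_def ip_scale scale_sum_right)

lemma ip_proj_basis:
  assumes "orthonormal E" "e \<in> E"
  shows "ip (proj E x) e = ip x e"
proof -
  have "ip (proj E x) e = (\<Sum>d\<in>E. if d = e then ip x e else 0)"
    unfolding proj_def ip_sum using assms by (intro sum.cong) (auto simp: ip_scale orthonormal_def)
  then show ?thesis using assms by (simp add: orthonormal_def)
qed

lemma ip_diff_proj:
  assumes "orthonormal E" "v \<in> span E"
  shows "ip v (x - proj E x) = 0"
  using assms(2)
proof (induction rule: span_induct_alt)
  case (step c e v)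
  have "ip (x - proj E x) e = 0" using ip_proj_basis[OF assms(1) step(1)] by (simp add: ip_diff)
  then show ?case using step by (simp add: ip_add ip_scale ip_eq_0_commute)
qed simp

lemma proj_eq_self_iff:
  assumes "orthonormal E"
  shows "proj E x = x \<longleftrightarrow> x \<in> span E"
proof
  assume "x \<in> span E"
  then have "ip (x - proj E x) (x - proj E x) = 0"
    using ip_diff_proj[OF assms] proj_in_span span_diff by blast
  then show "proj E x = x" using ip_self_eq_0 by fastforce
qed (metis proj_in_span)

lemma pythagoras_proj:
  assumes "orthonormal E"
  shows "(norm x)\<^sup>2 = (norm (proj E x))\<^sup>2 + (norm (x - proj E x))\<^sup>2"
proof -
  have "inner (proj E x) (x - proj E x) = 0"
    using ip_diff_proj[OF assms proj_in_span] by (simp flip: ip_inner_one)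
  then show ?thesis
    using norm_add_Pythagorean[of "proj E x" "x - proj E x"] by (simp add: orthogonal_def)
qed

lemma norm_proj_le: "orthonormal E \<Longrightarrow> norm (proj E x) \<le> norm x"
  and norm_diff_proj_le: "orthonormal E \<Longrightarrow> norm (x - proj E x) \<le> norm x"
  using pythagoras_proj[of E x] by (auto intro: power2_le_imp_le)

lemma bounded_linear_proj: "orthonormal E \<Longrightarrow> bounded_linear (proj E)"
  using norm_proj_le[of E] proj_scale[of E "of_real _"]
  by (intro bounded_linear_intro[of _ 1]) (simp_all add: proj_add scale_of_real)

text \<open>The span is the fixed point set of a continuous projection.\<close>

lemma closed_span_orthonormal:
  assumes "orthonormal E"
  shows "closed (span E)"
proof -
  have "span E = {x. proj E x = x}" using proj_eq_self_iff[OF assms] by blast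
  then show ?thesis
    using closed_Collect_eq[of "proj E" "\<lambda>x. x"] bounded_linear_proj[OF assms]
    by (simp add: linear_continuous_on)
qed

text \<open>Spans are over the scalars, and B may be dependent: a zero residual contributes no
  vector.\<close>

lemma gram_schmidt:
  assumes "finite B"
  obtains E where "orthonormal E" "span E = span B"
proof -
  have "\<exists>E. orthonormal E \<and> span E = span B"
    using assms
  proof (induction B rule: finite_induct)
    case empty
    show ?case by (intro exI[of _ "{}"]) (simp add: orthonormal_def)
  next
    case (insert b B)
    then obtain E where E: "orthonormal E" "span E = span B" by blast
    define r where "r = b - proj E b"
    have spr: "span (insert b E) = span (insert r E)"
    proof -
      have "b \<in> span (insert r E)"
        using span_add[OF span_base[of r "insert r E"] subsetD[OF span_mono proj_in_span], of E b]
        by (auto simp: r_def)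
      moreover have "r \<in> span (insert b E)"
        using span_diff[OF span_base[of b "insert b E"] subsetD[OF span_mono proj_in_span], of E b]
        by (auto simp: r_def)
      ultimately show ?thesis
        by (intro subset_antisym span_minimal subspace_span) (auto intro: span_base)
    qed
    have spb: "span (insert b E) = span (insert b B)"
      using E(2) by (simp add: span_insert)
    show ?case
    proof (cases "r = 0")
      case True
      then show ?thesis using E spr spb by auto
    next
      case False
      define u where "u = inverse (norm r) *\<^sub>R r"
      have "ip e r = 0" if "e \<in> E" for e
        using ip_diff_proj[OF E(1) span_base[OF that]] by (simp add: r_def)
      then have "ip u e = 0" "ip e u = 0" if "e \<in> E" for e
        using that ip_eq_0_commute[of e r] ip_eq_0_commute[of u e] by (simp_all add: u_def ip_scaleR)
      moreover have "norm u = 1" using False by (simp add: u_def)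
      then have "ip u u = 1" by (simp add: ip_norm)
      ultimately have "orthonormal (insert u E)"
        using E(1) by (auto simp: orthonormal_def)
      moreover have "span (insert u E) = span (insert r E)"
      proof -
        have u: "u = scale (of_real (inverse (norm r))) r" "r = scale (of_real (norm r)) u"
          using False by (simp_all add: u_def scale_of_real del: of_real_inverse)
        have "u \<in> span (insert r E)" by (subst u(1)) (intro span_scale span_base insertI1)
        moreover have "r \<in> span (insert u E)" by (subst u(2)) (intro span_scale span_base insertI1)
        ultimately show ?thesis
          by (intro subset_antisym span_minimal subspace_span) (auto intro: span_base)
      qed
      ultimately show ?thesis using spr spb by blast
    qed
  qed
  then show thesis using that by blast
qed

lemma finite_dimensional_subspace_orthonormal:
  assumes "subspace V" "finite_dimensional scale V"
  obtains E where "orthonormal E" "span E = V"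
proof -
  obtain F where F: "finite F" "V \<subseteq> span F" using assms(2) by (auto simp: finite_dimensional_def)
  obtain B where B: "B \<subseteq> V" "independent B" "V \<subseteq> span B"
    using maximal_independent_subset by blast
  have "finite B" using independent_span_bound[OF F(1) B(2)] B(1) F(2) by blast
  moreover have "span B = V" using B assms(1) by (meson span_minimal subset_antisym)
  ultimately show thesis using gram_schmidt that by metis
qed

end

lemma closed_dual: "closed (dual s)"
proof -
  have "dual s = (\<Inter>c. \<Inter>x. {f. blinfun_apply f (s c x) = c * blinfun_apply f x})"
    by (auto simp: dual_def)
  moreover have "closed {f. blinfun_apply f (s c x) = c * blinfun_apply f x}" for c x
    by (intro closed_Collect_eq continuous_intros)
  ultimately show ?thesis by (auto intro!: closed_INT)
qed

text \<open>The norm on pairs is Euclidean, hence induced by the sum of the inner products;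
  iteration makes the fourfold product a Hilbert space.\<close>

lemma hilbert_space_prod:
  assumes "hilbert_space s ip" "hilbert_space t ip'"
  shows "hilbert_space (prod_scale s t) (\<lambda>x y. ip (fst x) (fst y) + ip' (snd x) (snd y))"
proof -
  interpret s: hilbert_space s ip by fact
  interpret t: hilbert_space t ip' by fact
  interpret vector_space "prod_scale s t"
    by (intro vector_space_prod_scale) unfold_locales
  show ?thesis
  proof unfold_locales
    fix x y :: "'b \<times> 'c"
    show "ip (fst y) (fst x) + ip' (snd y) (snd x) =
      scalar_cnj (ip (fst x) (fst y) + ip' (snd x) (snd y))"
      by (simp add: scalar_cnj_add flip: s.ip_cnj t.ip_cnj)
    show "ip (fst x) (fst x) + ip' (snd x) (snd x) = of_real ((norm x)\<^sup>2)"
      by (simp add: s.ip_norm t.ip_norm norm_prod_def)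
  qed (simp_all add: prod_scale_def s.scale_of_real t.scale_of_real s.ip_add t.ip_add s.ip_scale
      t.ip_scale algebra_simps prod_eq_iff)
qed

section \<open>Finite rank approximable perturbations of isomorphisms\<close>

lemma bounded_opsD:
  assumes "T \<in> bounded_ops s t W"
  shows "bounded_linear T" "T (s c x) = t c (T x)" "T x \<in> W"
  using assms by (auto simp: bounded_ops_def)

lemma bounded_ops_linear:
  assumes "T \<in> bounded_ops s t W" "vector_space s" "vector_space t"
  shows "Vector_Spaces.linear s t T"
  using assms bounded_opsD[OF assms(1)]
  by (simp add: Vector_Spaces.linear_iff linear_add bounded_linear.linear)

lemma bounded_ops_add:
  assumes "vector_space t" "module.subspace t W"
    and "S \<in> bounded_ops s t W" "T \<in> bounded_ops s t W"
  shows "(\<lambda>x. S x + T x) \<in> bounded_ops s t W"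
proof -
  interpret vector_space t by fact
  show ?thesis
    using assms(2-) by (auto simp: bounded_ops_def subspace_add bounded_linear_add scale_right_distrib image_subset_iff)
qed

lemma bounded_ops_minus:
  assumes "vector_space t" "module.subspace t W" and "T \<in> bounded_ops s t W"
  shows "(\<lambda>x. - T x) \<in> bounded_ops s t W"
proof -
  interpret vector_space t by fact
  show ?thesis
    using assms(2-) by (auto simp: bounded_ops_def subspace_neg bounded_linear_minus image_subset_iff)
qed

lemma bounded_ops_compose:
  assumes "T \<in> bounded_ops s t W" "M \<in> bounded_ops r s V"
  shows "(\<lambda>x. T (M x)) \<in> bounded_ops r t W"
  using assms by (auto simp: bounded_ops_def image_subset_iff intro: bounded_linear_compose)

lemma bounded_ops_Pair:
  assumes "S \<in> bounded_ops s t W" "T \<in> bounded_ops s t' W'"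
  shows "(\<lambda>x. (S x, T x)) \<in> bounded_ops s (prod_scale t t') (W \<times> W')"
  using assms by (auto simp: bounded_ops_def prod_scale_def bounded_linear_Pair)

lemma finite_dimensional_subset:
  "finite_dimensional s V \<Longrightarrow> U \<subseteq> V \<Longrightarrow> finite_dimensional s U"
  unfolding finite_dimensional_def by blast

lemma finite_dimensional_add:
  assumes "vector_space t" "finite_dimensional t (range F)" "finite_dimensional t (range G)"
  shows "finite_dimensional t (range (\<lambda>x. F x + G x))"
proof -
  interpret vector_space t by fact
  obtain A B where "finite A" "range F \<subseteq> span A" "finite B" "range G \<subseteq> span B"
    using assms(2,3) by (auto simp: finite_dimensional_def)
  then show ?thesis
    unfolding finite_dimensional_def by (intro exI[of _ "A \<union> B"]) (fastforce simp: span_Un)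
qed

lemma finite_dimensional_image:
  assumes "Vector_Spaces.linear s t f" "finite_dimensional s V"
  shows "finite_dimensional t (f ` V)"
proof -
  interpret Vector_Spaces.linear s t f by fact
  obtain A where "finite A" "V \<subseteq> vs1.span A"
    using assms(2) by (auto simp: finite_dimensional_def)
  then show ?thesis
    unfolding finite_dimensional_def by (intro exI[of _ "f ` A"]) (auto simp: span_image)
qed

text \<open>The operator norm closure of the finite rank operators, written pointwise because
  operators are plain functions. Approximants must take values in W as well, so that the remainder
  can be absorbed into a bijection onto W.\<close>

definition finite_rank_approximable ::
  "('k::field \<Rightarrow> 'v \<Rightarrow> 'v) \<Rightarrow> ('k \<Rightarrow> 'w \<Rightarrow> 'w) \<Rightarrow> 'w set
    \<Rightarrow> ('v::real_normed_vector \<Rightarrow> 'w::real_normed_vector) \<Rightarrow> bool"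
  where "finite_rank_approximable s t W T \<longleftrightarrow> T \<in> bounded_ops s t W \<and>
    (\<forall>\<epsilon>>0. \<exists>F\<in>bounded_ops s t W. finite_dimensional t (range F) \<and> (\<forall>x. norm (T x - F x) \<le> \<epsilon> * norm x))"

lemma finite_rank_approximable_finite_rank:
  "T \<in> bounded_ops s t W \<Longrightarrow> finite_dimensional t (range T) \<Longrightarrow> finite_rank_approximable s t W T"
  unfolding finite_rank_approximable_def by (auto intro!: bexI[of _ T])

lemma finite_rank_approximable_add:
  assumes t: "vector_space t" "module.subspace t W"
    and S: "finite_rank_approximable s t W S" and T: "finite_rank_approximable s t W T"
  shows "finite_rank_approximable s t W (\<lambda>x. S x + T x)"
  unfolding finite_rank_approximable_def
proof (intro conjI allI impI)
  show "(\<lambda>x. S x + T x) \<in> bounded_ops s t W"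
    using S T by (intro bounded_ops_add t) (auto simp: finite_rank_approximable_def)
  fix e :: real assume "e > 0"
  then have "e / 2 > 0" by simp
  then obtain F G where F: "F \<in> bounded_ops s t W" "finite_dimensional t (range F)"
      "\<And>x. norm (S x - F x) \<le> e / 2 * norm x"
    and G: "G \<in> bounded_ops s t W" "finite_dimensional t (range G)"
      "\<And>x. norm (T x - G x) \<le> e / 2 * norm x"
    using S T unfolding finite_rank_approximable_def by meson
  have "norm (S x + T x - (F x + G x)) \<le> e * norm x" for x
    using norm_triangle_ineq[of "S x - F x" "T x - G x"] F(3)[of x] G(3)[of x]
    by (simp add: algebra_simps)
  then show "\<exists>H\<in>bounded_ops s t W. finite_dimensional t (range H) \<and>
      (\<forall>x. norm (S x + T x - H x) \<le> e * norm x)"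
    using bounded_ops_add[OF t F(1) G(1)] finite_dimensional_add[OF t(1) F(2) G(2)] by blast
qed

lemma finite_rank_approximable_minus:
  assumes t: "vector_space t" "module.subspace t W"
    and T: "finite_rank_approximable s t W T"
  shows "finite_rank_approximable s t W (\<lambda>x. - T x)"
  unfolding finite_rank_approximable_def
proof (intro conjI allI impI)
  show "(\<lambda>x. - T x) \<in> bounded_ops s t W"
    using T by (intro bounded_ops_minus t) (auto simp: finite_rank_approximable_def)
  fix e :: real assume "e > 0"
  then obtain F where F: "F \<in> bounded_ops s t W" "finite_dimensional t (range F)"
      "\<And>x. norm (T x - F x) \<le> e * norm x"
    using T unfolding finite_rank_approximable_def by meson
  interpret vector_space t by fact
  have "finite_dimensional t (range (\<lambda>x. - F x))"
  proof -
    obtain A where "finite A" "range F \<subseteq> span A"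
      using F(2) by (auto simp: finite_dimensional_def)
    then show ?thesis
      unfolding finite_dimensional_def by (intro exI[of _ A]) (auto intro: span_neg)
  qed
  moreover have "norm (- T x - - F x) \<le> e * norm x" for x
    using F(3)[of x] by (metis minus_diff_minus norm_minus_cancel)
  ultimately show "\<exists>H\<in>bounded_ops s t W. finite_dimensional t (range H) \<and>
      (\<forall>x. norm (- T x - H x) \<le> e * norm x)"
    using bounded_ops_minus[OF t F(1)] by blast
qed

lemma finite_rank_approximable_compose:
  assumes T: "finite_rank_approximable s t W T" and M: "M \<in> bounded_ops r s V"
  shows "finite_rank_approximable r t W (\<lambda>x. T (M x))"
  unfolding finite_rank_approximable_def
proof (intro conjI allI impI)
  show "(\<lambda>x. T (M x)) \<in> bounded_ops r t W"
    using T by (intro bounded_ops_compose[OF _ M]) (simp add: finite_rank_approximable_def)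
  obtain K where K: "K > 0" "\<And>x. norm (M x) \<le> norm x * K"
    using bounded_linear.pos_bounded[OF bounded_opsD(1)[OF M]] by blast
  fix e :: real assume "e > 0"
  then have "e / K > 0" using K by simp
  then obtain F where F: "F \<in> bounded_ops s t W" "finite_dimensional t (range F)"
      "\<And>x. norm (T x - F x) \<le> e / K * norm x"
    using T unfolding finite_rank_approximable_def by meson
  have "norm (T (M x) - F (M x)) \<le> e * norm x" for x
  proof -
    have "e / K * norm (M x) \<le> e / K * (norm x * K)"
      using K \<open>e > 0\<close> by (intro mult_left_mono) auto
    then show ?thesis using F(3)[of "M x"] K(1) by simp
  qed
  moreover have "finite_dimensional t (range (\<lambda>x. F (M x)))"
    by (rule finite_dimensional_subset[OF F(2)]) blast
  ultimately show "\<exists>H\<in>bounded_ops r t W. finite_dimensional t (range H) \<and>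
      (\<forall>x. norm (T (M x) - H x) \<le> e * norm x)"
    by (intro bexI[OF _ bounded_ops_compose[OF F(1) M]]) auto
qed

lemma finite_rank_approximable_Pair:
  assumes t: "vector_space t" "vector_space t'"
    and S: "finite_rank_approximable s t W S" and T: "finite_rank_approximable s t' W' T"
  shows "finite_rank_approximable s (prod_scale t t') (W \<times> W') (\<lambda>x. (S x, T x))"
  unfolding finite_rank_approximable_def
proof (intro conjI allI impI)
  show "(\<lambda>x. (S x, T x)) \<in> bounded_ops s (prod_scale t t') (W \<times> W')"
    using S T by (intro bounded_ops_Pair) (auto simp: finite_rank_approximable_def)
  fix e :: real assume "e > 0"
  then have "e / 2 > 0" by simp
  then obtain F G where F: "F \<in> bounded_ops s t W" "finite_dimensional t (range F)"
      "\<And>x. norm (S x - F x) \<le> e / 2 * norm x"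
    and G: "G \<in> bounded_ops s t' W'" "finite_dimensional t' (range G)"
      "\<And>x. norm (T x - G x) \<le> e / 2 * norm x"
    using S T unfolding finite_rank_approximable_def by meson
  have "norm ((S x, T x) - (F x, G x)) \<le> e * norm x" for x
    using norm_Pair_le[of "S x - F x" "T x - G x"] F(3)[of x] G(3)[of x] by simp
  moreover have "finite_dimensional (prod_scale t t') (range (\<lambda>x. (F x, G x)))"
  proof -
    have ps: "vector_space (prod_scale t t')" by (intro vector_space_prod_scale t)
    have "Vector_Spaces.linear t (prod_scale t t') (\<lambda>w. (w, 0))"
      "Vector_Spaces.linear t' (prod_scale t t') (\<lambda>w. (0, w))"
      using t ps by (auto simp: Vector_Spaces.linear_iff prod_scale_def vector_space.vector_space_assms
          module.scale_zero_right module_iff_vector_space)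
    from this[THEN finite_dimensional_image] F(2) G(2)
    have "finite_dimensional (prod_scale t t') (range (\<lambda>x. (F x, 0)))"
      "finite_dimensional (prod_scale t t') (range (\<lambda>x. (0, G x)))"
      by (force simp: image_image)+
    from finite_dimensional_add[OF ps this] show ?thesis by simp
  qed
  ultimately show "\<exists>H\<in>bounded_ops s (prod_scale t t') (W \<times> W').
      finite_dimensional (prod_scale t t') (range H) \<and> (\<forall>x. norm ((S x, T x) - H x) \<le> e * norm x)"
    by (intro bexI[OF _ bounded_ops_Pair[OF F(1) G(1)]]) auto
qed

text \<open>The controlled preimage of J x given by the open mapping theorem is x itself, by
  injectivity.\<close>

lemma bijective_bounded_below:
  fixes J :: "'a::banach \<Rightarrow> 'b::banach"
  assumes "bounded_linear J" "inj J" "closed (range J)"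
  obtains C where "C > 0" "\<And>x. norm x \<le> C * norm (J x)"
  using closed_range_open_mapping[OF assms(1,3)] \<open>inj J\<close> by (metis injD rangeI)

text \<open>With G = J^-1 F one has J + F = J (I + G), where G has finite rank; J carries the kernel
  and cokernel counts of I + G over to W.\<close>

lemma fredholm_iso_plus_finite_rank:
  fixes s :: "'k::{real_normed_field, euclidean_space} \<Rightarrow> 'a::{real_inner, banach} \<Rightarrow> 'a"
    and t :: "'k \<Rightarrow> 'b::banach \<Rightarrow> 'b"
  assumes "hilbert_space s ip" and t: "vector_space t" and W: "closed W"
    and J: "J \<in> bounded_ops s t W" "inj J" "range J = W"
    and F: "F \<in> bounded_ops s t W" "finite_dimensional t (range F)"
  shows "fredholm s t W (\<lambda>x. J x + F x)" "fredholm_index s t W (\<lambda>x. J x + F x) = 0"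
proof -
  interpret hilbert_space s ip by fact
  interpret t: vector_space t by fact
  have lJ: "Vector_Spaces.linear s t J"
    using J(1) by (intro bounded_ops_linear) unfold_locales
  have lF: "Vector_Spaces.linear s t F"
    using F(1) by (intro bounded_ops_linear) unfold_locales
  interpret J: Vector_Spaces.linear s t J by fact
  interpret F: Vector_Spaces.linear s t F by fact
  have bJ: "bounded_linear J" and bF: "bounded_linear F" using bounded_opsD J F by blast+
  obtain c where c: "c > 0" "\<And>x. norm x \<le> c * norm (J x)"
    using bijective_bounded_below[OF bJ J(2)] J(3) W by blast
  have subW: "t.subspace W" using J(3) J.subspace_image[OF subspace_UNIV] by simp
  define G where "G x = inv J (F x)" for x
  have JG: "J (G x) = F x" for x
    using bounded_opsD(3)[OF F(1)] J(3) by (simp add: G_def f_inv_into_f)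
  have lG: "Vector_Spaces.linear s s G"
    unfolding Vector_Spaces.linear_iff
    using vector_space_axioms by (auto intro!: injD[OF J(2)] simp: JG J.add J.scale F.add F.scale)
  interpret G: Vector_Spaces.linear s s G by fact
  obtain K where K: "\<And>x. norm (F x) \<le> norm x * K"
    using bounded_linear.bounded[OF bF] by blast
  have bG: "bounded_linear G"
  proof (rule bounded_linear_intro[of _ "c * K"])
    fix r x
    show "G (r *\<^sub>R x) = r *\<^sub>R G x" using G.scale[of "of_real r" x] by (simp add: scale_of_real)
    show "norm (G x) \<le> norm x * (c * K)"
      using c(2)[of "G x"] mult_left_mono[OF K[of x] less_imp_le[OF c(1)]] by (simp add: JG mult_ac)
  qed (rule G.add)
  obtain Z where Z: "finite Z" "range G \<subseteq> span Z"
  proof -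
    \<comment> \<open>The basis is taken inside range F, hence inside W, where \<open>inv J\<close>
      is a true right inverse.\<close>
    obtain B where B: "B \<subseteq> range F" "t.independent B" "range F \<subseteq> t.span B"
      using t.maximal_independent_subset by blast
    obtain B' where "finite B'" "range F \<subseteq> t.span B'"
      using F(2) by (auto simp: finite_dimensional_def)
    then have "finite B" using t.independent_span_bound B by blast
    moreover have "G x \<in> span (inv J ` B)" for x
    proof -
      have "J (inv J b) = b" if "b \<in> B" for b
        using B(1) JG that by (auto simp: G_def)
      then have "J ` inv J ` B = B" unfolding image_image by simp
      then have "J (G x) \<in> J ` span (inv J ` B)"
        unfolding J.span_image[symmetric] JG using B(3) by auto
      then show ?thesis using J(2) by (simp only: inj_image_mem_iff)
    qed
    ultimately show thesis using that[of "inv J ` B"] by blast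
  qed
  define S where "S x = x + G x" for x
  have lS: "Vector_Spaces.linear s s S"
    unfolding Vector_Spaces.linear_iff S_def
    using vector_space_axioms by (auto simp: G.add G.scale scale_right_distrib)
  interpret S: Vector_Spaces.linear s s S by fact
  have T: "(\<lambda>x. J x + F x) = (\<lambda>x. J (S x))" by (simp add: S_def J.add JG)
  have SZ: "S x - x \<in> span Z" for x using Z by (auto simp: S_def)
  obtain C B where CB: "finite C" "independent C" "span C = ker S"
    "finite B" "quotient_basis s UNIV (range S) B" "card B = card C"
    using identity_plus_finite_rank_index[OF lS Z(1) SZ] by metis
  have kerT: "ker (\<lambda>x. J (S x)) = span C"
    unfolding CB(3) ker_def using injD[OF J(2), of _ 0] by auto
  have ranT: "range (\<lambda>x. J (S x)) = J ` range S" by (simp add: image_image)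
  have qb: "quotient_basis t W (J ` range S) (J ` B)"
    using J.quotient_basis_image[OF J(2) CB(5)] J(3) by simp
  have "closed (range S)"
  proof -
    \<comment> \<open>S commutes with G, and G y = S v gives y = S y - G y = S (y - v). So the range
      is the preimage of a finite-dimensional, hence closed, space.\<close>
    have "range S = G -` (S ` span Z)"
    proof (intro equalityI subsetI)
      fix y assume "y \<in> range S"
      then obtain x where "y = S x" by blast
      then have "G y = S (G x)" by (simp add: S_def G.add)
      then show "y \<in> G -` (S ` span Z)" using Z(2) by blast
    next
      fix y assume "y \<in> G -` (S ` span Z)"
      then obtain v where "G y = S v" by blast
      then have "y = S (y - v)" by (simp add: S.diff) (simp add: S_def)
      then show "y \<in> range S" by blast
    qed
    moreover obtain E where "orthonormal E" "span E = span (S ` Z)"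
      using gram_schmidt[of "S ` Z"] Z(1) by blast
    then have "closed (S ` span Z)" using closed_span_orthonormal by (metis S.span_image)
    ultimately show ?thesis
      using closed_vimage linear_continuous_on[OF bG] by (metis continuous_on_eq_continuous_at open_UNIV)
  qed
  moreover have "Real_Vector_Spaces.linear S"
    using S.add S.scale[of "of_real _"] by (intro linearI) (simp_all add: scale_of_real)
  then have "Real_Vector_Spaces.subspace (range S)" by (simp add: linear_subspace_image)
  \<comment> \<open>J is bounded below, so it maps complete subspaces to complete ones, and these
    are closed in the target.\<close>
  ultimately have "complete (J ` range S)"
    by (intro complete_isometric_image[of "inverse c" _ J])
      (use c bJ in \<open>auto simp: complete_eq_closed field_simps\<close>)
  then have clT: "closed (range (\<lambda>x. J (S x)))" by (simp add: ranT complete_eq_closed)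
  have "(\<lambda>x. J x + F x) \<in> bounded_ops s t W"
    by (intro bounded_ops_add t subW J F)
  then show "fredholm s t W (\<lambda>x. J x + F x)"
    unfolding fredholm_def T using clT kerT CB(1,4) qb ranT
    by (auto simp: finite_dimensional_def finite_codim_def)
  have "codim t W (J ` range S) = card (J ` B)"
    using qb CB(4) J.subspace_image[OF S.subspace_image[OF subspace_UNIV]]
    by (intro t.codim_eq_card) auto
  also have "\<dots> = card C" using CB(6) J(2) by (simp add: card_image inj_on_subset)
  finally show "fredholm_index s t W (\<lambda>x. J x + F x) = 0"
    unfolding fredholm_index_def T kerT ranT by (simp add: dim_eq_card_independent CB(2))
qed

text \<open>The remainder E = R - F is small against J, so J + E is still a bijection onto W and
  only the finite rank F is left to add.\<close>

lemma fredholm_iso_plus_approximable: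
  fixes s :: "'k::{real_normed_field, euclidean_space} \<Rightarrow> 'a::{real_inner, banach} \<Rightarrow> 'a"
    and t :: "'k \<Rightarrow> 'b::banach \<Rightarrow> 'b"
  assumes s: "hilbert_space s ip" and t: "vector_space t" and W: "closed W"
    and J: "J \<in> bounded_ops s t W" "inj J" "range J = W"
    and R: "finite_rank_approximable s t W R"
  shows "fredholm s t W (\<lambda>x. J x + R x) \<and> fredholm_index s t W (\<lambda>x. J x + R x) = 0"
proof -
  interpret hilbert_space s ip by fact
  interpret t: vector_space t by fact
  have lJ: "Vector_Spaces.linear s t J"
    using J(1) by (intro bounded_ops_linear) unfold_locales
  interpret J: Vector_Spaces.linear s t J by fact
  have bJ: "bounded_linear J" using bounded_opsD J by blast
  obtain c where c: "c > 0" "\<And>x. norm x \<le> c * norm (J x)"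
    using bijective_bounded_below[OF bJ J(2)] J(3) W by blast
  have subW: "t.subspace W" using J(3) J.subspace_image[OF subspace_UNIV] by simp
  \<comment> \<open>c bounds the inverse of J, so with this tolerance J^-1 E has norm at most
    1/2.\<close>
  have "1 / (2 * c) > 0" using c by simp
  then obtain F where F: "F \<in> bounded_ops s t W" "finite_dimensional t (range F)"
      "\<And>x. norm (R x - F x) \<le> 1 / (2 * c) * norm x"
    using R unfolding finite_rank_approximable_def by meson
  define E where "E x = R x + - F x" for x
  have E: "E \<in> bounded_ops s t W"
    unfolding E_def[abs_def] using R F
    by (intro bounded_ops_add bounded_ops_minus t subW) (auto simp: finite_rank_approximable_def)
  have cE: "c * norm (E x) \<le> norm x / 2" for x
    using mult_left_mono[OF F(3)[of x] less_imp_le[OF c(1)]] c(1) by (simp add: E_def)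
  have E_diff: "E (x - y) = E x - E y" for x y
    by (intro linear_diff bounded_linear.linear bounded_opsD(1)[OF E])
  let ?J = "\<lambda>x. J x + E x"
  have J': "?J \<in> bounded_ops s t W" by (intro bounded_ops_add t subW J E)
  have "inj ?J"
  proof (rule injI)
    fix x y assume "J x + E x = J y + E y"
    then have "J (x - y) = - E (x - y)" by (simp add: J.diff E_diff algebra_simps)
    then have "norm (x - y) \<le> 0"
      using c(2)[of "x - y"] cE[of "x - y"] unfolding \<open>J (x - y) = _\<close> norm_minus_cancel by linarith
    then show "x = y" by simp
  qed
  moreover have "range ?J = W"
  proof
    show "range ?J \<subseteq> W" using J' by (auto simp: bounded_ops_def)
    show "W \<subseteq> range ?J"
    proof
      fix w assume w: "w \<in> W"
      \<comment> \<open>Solutions of J x + E x = w are the fixed points of this contraction.\<close>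
      define f where "f x = inv J (w - E x)" for x
      have Jf: "J (f x) = w - E x" for x
      proof -
        have "w - E x \<in> range J"
          unfolding J(3) using subW w bounded_opsD(3)[OF E] by (simp add: t.subspace_diff)
        then show ?thesis by (simp add: f_def f_inv_into_f)
      qed
      have "dist (f x) (f y) \<le> 1/2 * dist x y" for x y
      proof -
        have "J (f x - f y) = - E (x - y)" by (simp add: J.diff Jf E_diff)
        then show ?thesis
          using c(2)[of "f x - f y"] cE[of "x - y"] by (simp add: dist_norm)
      qed
      then obtain x where "f x = x" using banach_fix_type[of "1/2" f] by auto
      then have "J x + E x = w" using Jf[of x] by simp
      then show "w \<in> range ?J" by blast
    qed
  qed
  ultimately have "fredholm s t W (\<lambda>x. ?J x + F x)" "fredholm_index s t W (\<lambda>x. ?J x + F x) = 0"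
    using fredholm_iso_plus_finite_rank[OF s t W J' _ _ F(1,2)] by auto
  moreover have "(\<lambda>x. ?J x + F x) = (\<lambda>x. J x + R x)" by (simp add: E_def algebra_simps)
  ultimately show ?thesis by simp
qed

section \<open>Adjoints and compact operators\<close>

lemma dual_scale_apply [simp]: "blinfun_apply (dual_scale c f) x = c * blinfun_apply f x"
  by (simp add: dual_scale_def)

lemma subspace_dual: "module.subspace dual_scale (dual s)"
proof -
  interpret vector_space dual_scale by (rule vector_space_dual_scale)
  show ?thesis
    by (auto simp: subspace_def dual_def plus_blinfun.rep_eq algebra_simps)
qed

lemma bounded_ops_dualD:
  assumes "T \<in> bounded_ops s dual_scale (dual r)"
  shows "blinfun_apply (T (s c x)) y = c * blinfun_apply (T x) y"
    "blinfun_apply (T x) (r c y) = c * blinfun_apply (T x) y"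
  using bounded_opsD(2,3)[OF assms] by (auto simp: dual_def)

text \<open>Built from the bilinear evaluation pairing, the adjoint is linear and not
  conjugate-linear over the scalars, and it inherits the bound of T.\<close>

lemma adjoint_op_bounded_ops:
  assumes T: "T \<in> bounded_ops s dual_scale (dual r)"
  shows "adjoint_op T \<in> bounded_ops r dual_scale (dual s)"
proof -
  have bT: "bounded_linear T" using bounded_opsD T by blast
  note app = adjoint_op_apply[OF bT]
  obtain K where K: "\<And>x. norm (T x) \<le> norm x * K" "K \<ge> 0"
    using bounded_linear.nonneg_bounded[OF bT] by blast
  have "bounded_linear (adjoint_op T)"
  proof (rule bounded_linear_intro[of _ K])
    show "norm (adjoint_op T z) \<le> norm z * K" for z
    proof (rule norm_blinfun_bound)
      fix x
      have "norm (blinfun_apply (T x) z) \<le> norm (T x) * norm z" by (rule norm_blinfun)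
      also have "\<dots> \<le> norm x * K * norm z" using K by (intro mult_right_mono) auto
      finally show "norm (blinfun_apply (adjoint_op T z) x) \<le> norm z * K * norm x"
        by (simp add: app mult_ac)
    qed (use K in auto)
  qed (auto intro!: blinfun_eqI simp: app blinfun.add_left blinfun.add_right blinfun.scaleR_left blinfun.scaleR_right)
  then show ?thesis
    using bounded_ops_dualD[OF T]
    by (auto intro!: blinfun_eqI simp: bounded_ops_def app dual_def)
qed

context hilbert_space
begin

lemma norm_ip_functional_le: "norm (ip_functional y) \<le> 2 * norm y"
  by (rule norm_blinfun_bound) (use norm_ip_le in \<open>auto simp: mult_ac\<close>)

lemma ip_scaleR_right: "ip x (r *\<^sub>R y) = r *\<^sub>R ip x y"
proof -
  have "ip x (r *\<^sub>R y) = scalar_cnj (of_real r * ip y x)"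
    by (simp add: ip_cnj[of x "r *\<^sub>R y"] ip_scaleR scaleR_conv_of_real)
  also have "\<dots> = r *\<^sub>R ip x y"
    unfolding scalar_cnj_of_real_mult ip_cnj[of x y, symmetric] by (simp add: scaleR_conv_of_real)
  finally show ?thesis .
qed

text \<open>Real linearity only, as \<open>ip_functional\<close> is conjugate-linear over complex
  scalars; this suffices for pulling back closed real subspaces.\<close>

lemma bounded_linear_ip_functional: "bounded_linear ip_functional"
  by (rule bounded_linear_intro[of _ 2])
    (use norm_ip_functional_le in \<open>auto intro!: blinfun_eqI
      simp: mult_ac ip_add_right ip_scaleR_right blinfun.add_left blinfun.scaleR_left\<close>)

lemma dual_expand_proj:
  assumes "f \<in> dual scale"
  shows "blinfun_apply f (proj E x) = (\<Sum>e\<in>E. ip x e * blinfun_apply f e)"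
  using assms by (simp add: proj_def blinfun.sum_right dual_def)

text \<open>One estimate serves both T and its adjoint, as x and z enter it alike. A finite net of
  the image of the unit ball is represented by finitely many vectors; if E spans these, every net
  functional vanishes on \<open>z - proj E z\<close>.\<close>

lemma compact_op_proj_approximation:
  assumes T: "compact_op r dual_scale (dual scale) T" and "e > 0"
  obtains E where "orthonormal E"
    "\<And>x z. norm (blinfun_apply (T x) (z - proj E z)) \<le> e * norm x * norm z"
proof -
  have T': "T \<in> bounded_ops r dual_scale (dual scale)" "compact (closure (T ` cball 0 1))"
    using T by (auto simp: compact_op_def)
  interpret T: bounded_linear T using bounded_opsD T'(1) by blast
  obtain N where N: "finite N" "N \<subseteq> closure (T ` cball 0 1)"
      "closure (T ` cball 0 1) \<subseteq> (\<Union>f\<in>N. ball f e)"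
  proof (rule compactE_image[OF T'(2), of "closure (T ` cball 0 1)" "\<lambda>f. ball f e"])
    show "closure (T ` cball 0 1) \<subseteq> (\<Union>f\<in>closure (T ` cball 0 1). ball f e)"
      using \<open>e > 0\<close> by (meson UN_I centre_in_ball subsetI)
  qed auto
  \<comment> \<open>Net points lie only in the closure of the image; closedness of the dual makes
    Riesz applicable to them.\<close>
  have "closure (T ` cball 0 1) \<subseteq> dual scale"
    using bounded_opsD(3)[OF T'(1)] by (intro closure_minimal closed_dual) auto
  then have "\<forall>f\<in>N. \<exists>y. f = ip_functional y" using N(2) riesz by blast
  then obtain y where y: "\<And>f. f \<in> N \<Longrightarrow> f = ip_functional (y f)" by metis
  obtain E where E: "orthonormal E" "span E = span (y ` N)"
    using gram_schmidt[of "y ` N"] N(1) by blast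
  have kill: "blinfun_apply f (z - proj E z) = 0" if "f \<in> N" for f z
  proof -
    have "y f \<in> span E" unfolding E(2) using that by (intro span_base) blast
    then show ?thesis
      by (subst y[OF that]) (simp add: ip_eq_0_commute ip_diff_proj[OF E(1)])
  qed
  have unit: "norm (blinfun_apply (T x) (z - proj E z)) \<le> e * norm z" if "norm x \<le> 1" for x z
  proof -
    have "T x \<in> closure (T ` cball 0 1)" using that closure_subset by fastforce
    then obtain f where f: "f \<in> N" "norm (T x - f) < e"
      using N(3) by (force simp: dist_norm norm_minus_commute)
    have "norm (blinfun_apply (T x) (z - proj E z)) = norm (blinfun_apply (T x - f) (z - proj E z))"
      using kill[OF f(1), of z] by (simp add: blinfun.diff_left)
    also have "\<dots> \<le> norm (T x - f) * norm (z - proj E z)" by (rule norm_blinfun)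
    also have "\<dots> \<le> e * norm z"
      using f(2) norm_diff_proj_le[OF E(1)] \<open>e > 0\<close> by (intro mult_mono) auto
    finally show ?thesis .
  qed
  have "norm (blinfun_apply (T x) (z - proj E z)) \<le> e * norm x * norm z" for x z
  proof (cases "x = 0")
    case False
    define u where "u = inverse (norm x) *\<^sub>R x"
    have "x = norm x *\<^sub>R u" "norm u \<le> 1" using False by (simp_all add: u_def)
    then have "norm (blinfun_apply (T x) (z - proj E z)) = norm x * norm (blinfun_apply (T u) (z - proj E z))"
      by (metis T.scaleR blinfun.scaleR_left norm_scaleR abs_norm_cancel)
    also have "\<dots> \<le> norm x * (e * norm z)"
      using unit[OF \<open>norm u \<le> 1\<close>] by (intro mult_left_mono) auto
    finally show ?thesis by (simp add: mult_ac)
  qed (simp add: T.zero)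
  with E(1) show thesis by (rule that)
qed

text \<open>Composing the functional T x with the projection gives a combination of the finitely
  many \<open>ip_functional d\<close> with d in E.\<close>

lemma compact_op_approximable:
  assumes T: "compact_op r dual_scale (dual scale) T"
  shows "finite_rank_approximable r dual_scale (dual scale) T"
  unfolding finite_rank_approximable_def
proof (intro conjI allI impI)
  show T': "T \<in> bounded_ops r dual_scale (dual scale)" using T by (simp add: compact_op_def)
  interpret T: bounded_linear T using bounded_opsD T' by blast
  interpret D: vector_space dual_scale by (rule vector_space_dual_scale)
  fix e :: real assume "e > 0"
  then obtain E where E: "orthonormal E"
    "\<And>x z. norm (blinfun_apply (T x) (z - proj E z)) \<le> e * norm x * norm z"
    using compact_op_proj_approximation[OF T] by blast
  define p where "p = Blinfun (proj E)"
  have p: "blinfun_apply p = proj E"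
    unfolding p_def using bounded_linear_proj[OF E(1)] by (rule bounded_linear_Blinfun_apply)
  define F where "F x = T x o\<^sub>L p" for x
  have F: "blinfun_apply (F x) z = blinfun_apply (T x) (proj E z)" for x z
    by (simp add: F_def p)
  have "bounded_linear F"
    unfolding F_def by (intro bounded_linear_compose[OF bounded_bilinear.bounded_linear_left[OF bounded_bilinear_blinfun_compose]] T.bounded_linear_axioms)
  then have "F \<in> bounded_ops r dual_scale (dual scale)"
    using bounded_ops_dualD[OF T'] by (auto intro!: blinfun_eqI simp: bounded_ops_def dual_def F proj_scale)
  moreover have F_sum: "F x = (\<Sum>d\<in>E. dual_scale (blinfun_apply (T x) d) (ip_functional d))" for x
    using bounded_opsD(3)[OF T', of x]
    by (intro blinfun_eqI) (simp add: F dual_expand_proj blinfun.sum_left mult.commute)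
  have "F x \<in> D.span (ip_functional ` E)" for x
    unfolding F_sum by (intro D.span_sum D.span_scale D.span_base imageI)
  then have "range F \<subseteq> D.span (ip_functional ` E)" by blast
  then have "finite_dimensional dual_scale (range F)"
    using E(1) unfolding finite_dimensional_def orthonormal_def by blast
  moreover have "norm (T x - F x) \<le> e * norm x" for x
    using E(2)[of x] \<open>e > 0\<close>
    by (intro norm_blinfun_bound) (simp_all add: blinfun.diff_left blinfun.diff_right F)
  ultimately show "\<exists>F\<in>bounded_ops r dual_scale (dual scale). finite_dimensional dual_scale (range F) \<and>
      (\<forall>x. norm (T x - F x) \<le> e * norm x)"
    by blast
qed

text \<open>The same estimate, read with z as the argument, bounds the error of projecting before
  applying the adjoint, so no separate compactness proof for the adjoint is made.\<close>

lemma compact_op_adjoint_approximable: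
  assumes T: "compact_op r dual_scale (dual scale) T"
  shows "finite_rank_approximable scale dual_scale (dual r) (adjoint_op T)"
  unfolding finite_rank_approximable_def
proof (intro conjI allI impI)
  have T': "T \<in> bounded_ops r dual_scale (dual scale)" using T by (simp add: compact_op_def)
  show A: "adjoint_op T \<in> bounded_ops scale dual_scale (dual r)" by (rule adjoint_op_bounded_ops[OF T'])
  interpret A: Vector_Spaces.linear scale dual_scale "adjoint_op T"
    by (rule bounded_ops_linear[OF A vector_space_axioms vector_space_dual_scale])
  fix e :: real assume "e > 0"
  then obtain E where E: "orthonormal E"
    "\<And>x z. norm (blinfun_apply (T x) (z - proj E z)) \<le> e * norm x * norm z"
    using compact_op_proj_approximation[OF T] by blast
  have "proj E \<in> bounded_ops scale scale UNIV"
    using bounded_linear_proj[OF E(1)] by (simp add: bounded_ops_def proj_scale)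
  then have "(\<lambda>z. adjoint_op T (proj E z)) \<in> bounded_ops scale dual_scale (dual r)"
    by (rule bounded_ops_compose[OF A])
  moreover have "finite_dimensional dual_scale (range (\<lambda>z. adjoint_op T (proj E z)))"
    unfolding finite_dimensional_def
    using E(1) proj_in_span[of E]
    by (intro exI[of _ "adjoint_op T ` E"]) (auto simp: orthonormal_def A.span_image)
  moreover have "norm (adjoint_op T z - adjoint_op T (proj E z)) \<le> e * norm z" for z
  proof -
    have "adjoint_op T z - adjoint_op T (proj E z) = adjoint_op T (z - proj E z)"
      by (simp add: A.diff)
    then show ?thesis
      using E(2)[of _ z] \<open>e > 0\<close> bounded_opsD(1)[OF T']
      by (auto intro!: norm_blinfun_bound simp: adjoint_op_apply mult_ac)
  qed
  ultimately show "\<exists>F\<in>bounded_ops scale dual_scale (dual r). finite_dimensional dual_scale (range F) \<and>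
      (\<forall>z. norm (adjoint_op T z - F z) \<le> e * norm z)"
    by (intro bexI) auto
qed

end

section \<open>Closed range and bordering of a Fredholm operator\<close>

context
  fixes s :: "'k::{real_normed_field, euclidean_space} \<Rightarrow> 'a::{real_inner, banach} \<Rightarrow> 'a"
    and r :: "'k \<Rightarrow> 'b::{real_inner, banach} \<Rightarrow> 'b"
    and ip ip' and A :: "'a \<Rightarrow> ('b \<Rightarrow>\<^sub>L 'k)"
  assumes s: "hilbert_space s ip" and r: "hilbert_space r ip'"
    and A: "A \<in> bounded_ops s dual_scale (dual r)" and cl: "closed (range A)"
begin

interpretation s: hilbert_space s ip by (rule s)
interpretation r: hilbert_space r ip' by (rule r)

text \<open>Passing to Riesz vectors moves range A into a Hilbert space, where orthogonal projection
  is available.\<close>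

lemma subspace_closed_representers:
  "subspace (r.ip_functional -` range A)" "closed (r.ip_functional -` range A)"
proof -
  have "bounded_linear A" using bounded_opsD A by blast
  then show "subspace (r.ip_functional -` range A)"
    by (intro linear_subspace_vimage linear_subspace_image bounded_linear.linear
        r.bounded_linear_ip_functional subspace_UNIV)
  show "closed (r.ip_functional -` range A)"
    by (intro closed_vimage cl linear_continuous_on r.bounded_linear_ip_functional)
qed

text \<open>Project the representer z of h onto the representers of range A, with image p. The
  residual u = z - p is killed by the adjoint, so h u = 0 and u is orthogonal to z; being orthogonal
  to p as well, it vanishes.\<close>

lemma range_eq_annihilator:
  assumes h: "h \<in> dual r" and ann: "\<And>z. adjoint_op A z = 0 \<Longrightarrow> blinfun_apply h z = 0"
  shows "h \<in> range A"
proof -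
  let ?R = "r.ip_functional -` range A"
  obtain z where z: "h = r.ip_functional z" using r.riesz[OF h] by blast
  obtain p where p: "p \<in> ?R" "\<And>x. x \<in> ?R \<Longrightarrow> inner x z = inner x p"
    using closed_subspace_riesz[OF subspace_closed_representers, of "\<lambda>x. inner x z" "norm z"]
    by (auto simp: inner_add_left Cauchy_Schwarz_ineq2 mult.commute)
  define u where "u = z - p"
  have orth: "inner x u = 0" if "x \<in> ?R" for x using p(2)[OF that] by (simp add: u_def inner_diff_right)
  have Au: "blinfun_apply (A y) u \<bullet> 1 = 0" for y
  proof -
    obtain x where "A y = r.ip_functional x" using r.riesz[OF bounded_opsD(3)[OF A]] by blast
    moreover from this have "x \<in> ?R" by (metis rangeI vimageI)
    then have "inner u x = 0" using orth by (metis inner_commute)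
    ultimately show ?thesis by (simp add: r.ip_inner_one)
  qed
  have "adjoint_op A u = 0"
  proof (rule blinfun_eqI)
    fix y
    have "blinfun_apply (A y) u = 0"
    proof (rule scalar_eq_0_if_inner_one)
      show "(c * blinfun_apply (A y) u) \<bullet> 1 = 0" for c
        using Au[of "s c y"] bounded_ops_dualD(1)[OF A, of c y u] by simp
    qed
    then show "blinfun_apply (adjoint_op A u) y = blinfun_apply 0 y"
      using bounded_opsD(1)[OF A] by (simp add: adjoint_op_apply)
  qed
  then have "ip' u z = 0" using ann z by simp
  then have "inner u z = 0" using r.ip_inner_one[of u z] by simp
  then have "inner u u = 0" using orth[OF p(1)] by (simp add: u_def inner_diff_right inner_diff_left inner_commute)
  then have "z = p" by (simp add: u_def)
  then show ?thesis using p(1) z by simp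
qed

text \<open>As f vanishes on ker A, it descends to a functional on range A. Open mapping makes that
  functional bounded, and its Riesz vector is the required preimage under the adjoint.\<close>

lemma range_adjoint_eq_annihilator:
  assumes f: "f \<in> dual s" and ann: "\<And>x. A x = 0 \<Longrightarrow> blinfun_apply f x = 0"
  shows "f \<in> range (adjoint_op A)"
proof -
  let ?R = "r.ip_functional -` range A"
  have bA: "bounded_linear A" using bounded_opsD A by blast
  interpret A: bounded_linear A by fact
  obtain C where C: "C > 0" "\<And>w. w \<in> range A \<Longrightarrow> \<exists>x. A x = w \<and> norm x \<le> C * norm w"
    using closed_range_open_mapping[OF bA cl] by blast
  have same: "blinfun_apply f x = blinfun_apply f y" if "A x = A y" for x y
    using ann[of "x - y"] that by (simp add: A.diff blinfun.diff_right)
  \<comment> \<open>The choice is harmless: by \<open>same\<close>, f is constant on each fibre of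
    A.\<close>
  define g where "g z = blinfun_apply f (SOME x. A x = r.ip_functional z) \<bullet> 1" for z
  have g: "g z = blinfun_apply f x \<bullet> 1" if "A x = r.ip_functional z" for x z
    unfolding g_def using someI[of "\<lambda>x. A x = r.ip_functional z", OF that] that same by metis
  interpret R: bounded_linear r.ip_functional by (rule r.bounded_linear_ip_functional)
  obtain y where y: "y \<in> ?R" "\<And>z. z \<in> ?R \<Longrightarrow> g z = inner z y"
  proof (rule closed_subspace_riesz[OF subspace_closed_representers])
    fix z w assume "z \<in> ?R" "w \<in> ?R"
    then obtain x y where "A x = r.ip_functional z" "A y = r.ip_functional w" by fastforce
    then show "g (z + w) = g z + g w"
      using g[of x z] g[of y w] g[of "x + y" "z + w"]
      by (simp add: A.add R.add blinfun.add_right inner_add_left)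
  next
    fix c z assume "z \<in> ?R"
    then obtain x where "A x = r.ip_functional z" by fastforce
    then show "g (c *\<^sub>R z) = c * g z"
      using g[of x z] g[of "c *\<^sub>R x" "c *\<^sub>R z"] by (simp add: A.scaleR R.scaleR blinfun.scaleR_right)
  next
    fix z assume "z \<in> ?R"
    then obtain x where x: "A x = r.ip_functional z" "norm x \<le> C * norm (r.ip_functional z)"
      using C(2)[of "r.ip_functional z"] by auto
    have "\<bar>g z\<bar> \<le> norm (blinfun_apply f x)"
      using Cauchy_Schwarz_ineq2[of "blinfun_apply f x" 1] g[OF x(1)] by simp
    also have "\<dots> \<le> norm f * norm x" by (rule norm_blinfun)
    also have "\<dots> \<le> norm f * (C * (2 * norm z))"
      using x(2) C(1) r.norm_ip_functional_le[of z]
      by (intro mult_left_mono order_trans[OF x(2)]) auto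
    finally show "\<bar>g z\<bar> \<le> norm f * C * 2 * norm z" by (simp add: mult_ac)
  qed blast
  have key: "blinfun_apply f x \<bullet> 1 = blinfun_apply (A x) y \<bullet> 1" for x
  proof -
    obtain z where z: "A x = r.ip_functional z" using r.riesz[OF bounded_opsD(3)[OF A]] by blast
    then have "z \<in> ?R" by (metis rangeI vimageI)
    moreover have "blinfun_apply (A x) y \<bullet> 1 = inner y z" by (simp add: z r.ip_inner_one)
    ultimately show ?thesis using g[OF z] y(2) by (metis inner_commute)
  qed
  have "f = adjoint_op A y"
  proof (rule blinfun_eqI)
    fix x
    have "blinfun_apply f x - blinfun_apply (A x) y = 0"
    proof (rule scalar_eq_0_if_inner_one)
      show "(c * (blinfun_apply f x - blinfun_apply (A x) y)) \<bullet> 1 = 0" for c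
        using key[of "s c x"] f bounded_ops_dualD(1)[OF A, of c x y]
        by (simp add: dual_def inner_diff_left algebra_simps)
    qed
    then show "blinfun_apply f x = blinfun_apply (adjoint_op A y) x"
      using bA by (simp add: adjoint_op_apply)
  qed
  then show ?thesis by blast
qed

end

text \<open>Each functional b costs at most one dimension: V is spanned by its part U in the kernel
  of b and a single v with b v nonzero.\<close>

lemma finite_dimensional_separating_functionals:
  fixes s :: "'k::{real_normed_field, euclidean_space} \<Rightarrow> 'a::real_normed_vector \<Rightarrow> 'a"
  assumes "vector_space s" "finite B" "B \<subseteq> dual s" "module.subspace s V"
    and "\<And>x. x \<in> V \<Longrightarrow> (\<And>b. b \<in> B \<Longrightarrow> blinfun_apply b x = 0) \<Longrightarrow> x = 0"
  shows "finite_dimensional s V"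
proof -
  interpret vector_space s by fact
  show ?thesis
    using assms(2-5)
  proof (induction B arbitrary: V rule: finite_induct)
    case empty
    then show ?case unfolding finite_dimensional_def by (intro exI[of _ "{}"]) auto
  next
    case (insert b B)
    have b: "blinfun_apply b (s c x) = c * blinfun_apply b x" for c x
      using insert.prems(1) by (auto simp: dual_def)
    define U where "U = {x \<in> V. blinfun_apply b x = 0}"
    have "subspace U" using insert.prems(2)
      by (auto simp: U_def subspace_def b blinfun.add_right)
    then have "finite_dimensional s U"
      using insert.prems by (intro insert.IH) (auto simp: U_def)
    then obtain F where F: "finite F" "U \<subseteq> span F" by (auto simp: finite_dimensional_def)
    show ?case
    proof (cases "U = V")
      case True
      then show ?thesis using F by (auto simp: finite_dimensional_def)
    next
      case False
      then obtain v where v: "v \<in> V" "blinfun_apply b v \<noteq> 0" by (auto simp: U_def)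
      have "x \<in> span (insert v F)" if x: "x \<in> V" for x
      proof -
        define c where "c = blinfun_apply b x / blinfun_apply b v"
        have "x - s c v \<in> U"
          using x v insert.prems(2)
          by (simp add: U_def subspace_diff subspace_scale blinfun.diff_right b c_def)
        then show ?thesis using F(2) by (auto simp: span_insert)
      qed
      then show ?thesis using F(1) unfolding finite_dimensional_def by (intro exI[of _ "insert v F"]) auto
    qed
  qed
qed

text \<open>A vector z killed by the adjoint is annihilated by range A. If the finitely many
  functionals complementing range A kill it too, then so does \<open>ip_functional z\<close>; hence
  they separate the kernel.\<close>

lemma finite_dimensional_ker_adjoint:
  assumes r: "hilbert_space r ip'" and A: "A \<in> bounded_ops s dual_scale (dual r)"
    and "finite_codim dual_scale (dual r) (range A)"
  shows "finite_dimensional r (ker (adjoint_op A))"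
proof -
  interpret r: hilbert_space r ip' by (rule r)
  interpret D: vector_space dual_scale by (rule vector_space_dual_scale)
  interpret A: Vector_Spaces.linear r dual_scale "adjoint_op A"
    by (rule bounded_ops_linear[OF adjoint_op_bounded_ops[OF A] r.vector_space_axioms vector_space_dual_scale])
  obtain B where B: "finite B" "B \<subseteq> dual r" "dual r \<subseteq> D.span (range A \<union> B)"
    using assms(3) by (auto simp: finite_codim_def quotient_basis_def)
  have "z = 0" if z: "adjoint_op A z = 0" "\<And>b. b \<in> B \<Longrightarrow> blinfun_apply b z = 0" for z
  proof -
    have "blinfun_apply (A x) z = 0" for x
      using adjoint_op_apply[OF bounded_opsD(1)[OF A], of z x] z(1) by simp
    then have "range A \<union> B \<subseteq> {f. blinfun_apply f z = 0}" using z(2) by auto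
    moreover have "D.subspace {f. blinfun_apply f z = 0}"
      by (auto simp: D.subspace_def blinfun.add_left)
    ultimately have "D.span (range A \<union> B) \<subseteq> {f. blinfun_apply f z = 0}" by (rule D.span_minimal)
    then have "ip' z z = 0" using B(3) r.ip_functional_dual[of z] by auto
    then show ?thesis by (rule r.ip_self_eq_0)
  qed
  moreover have "r.subspace (ker (adjoint_op A))" unfolding ker_def by (rule A.subspace_kernel)
  ultimately show ?thesis
    using B by (intro finite_dimensional_separating_functionals[of r B] r.vector_space_axioms)
      (auto simp: ker_def)
qed

section \<open>Finite rank forms on finite-dimensional subspaces\<close>

context hilbert_space
begin

text \<open>
  Bilinear and not sesquilinear, so that \<open>pairing E\<close> is linear over the scalars.
\<close>

definition pairing :: "'a set \<Rightarrow> 'a \<Rightarrow> ('a \<Rightarrow>\<^sub>L 'k)"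
  where "pairing E x = (\<Sum>e\<in>E. dual_scale (ip x e) (ip_functional e))"

lemma pairing_apply: "blinfun_apply (pairing E x) y = (\<Sum>e\<in>E. ip x e * ip y e)"
  by (simp add: pairing_def blinfun.sum_left)

lemma pairing_basis:
  assumes "orthonormal E" "e \<in> E"
  shows "blinfun_apply (pairing E x) e = ip x e"
proof -
  have "blinfun_apply (pairing E x) e = (\<Sum>d\<in>E. if d = e then ip x e else 0)"
    unfolding pairing_apply using assms by (intro sum.cong) (auto simp: orthonormal_def)
  then show ?thesis using assms by (simp add: orthonormal_def)
qed

lemma pairing_bounded_ops: "pairing E \<in> bounded_ops scale dual_scale (dual scale)"
proof -
  have "bounded_linear (\<lambda>x. dual_scale (ip x e) (ip_functional e))" for e
  proof (rule bounded_linear_intro[of _ "2 * norm e * norm (ip_functional e)"])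
    fix x
    have "norm (dual_scale (ip x e) (ip_functional e)) \<le> norm (ip x e) * norm (ip_functional e)"
    proof (rule norm_blinfun_bound)
      show "norm (blinfun_apply (dual_scale (ip x e) (ip_functional e)) y)
          \<le> norm (ip x e) * norm (ip_functional e) * norm y" for y
        using mult_left_mono[OF norm_blinfun[of "ip_functional e" y] norm_ge_zero[of "ip x e"]]
        by (simp add: norm_mult mult_ac)
    qed simp
    also have "\<dots> \<le> (2 * norm x * norm e) * norm (ip_functional e)"
      by (intro mult_right_mono norm_ip_le) simp
    finally show "norm (dual_scale (ip x e) (ip_functional e)) \<le> norm x * (2 * norm e * norm (ip_functional e))"
      by (simp add: mult_ac)
  qed (auto intro!: blinfun_eqI simp: ip_add ip_scaleR blinfun.add_left blinfun.scaleR_left algebra_simps)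
  then have "bounded_linear (pairing E)"
    unfolding pairing_def[abs_def] by (intro bounded_linear_sum)
  then show ?thesis
    by (auto intro!: blinfun_eqI
        simp: bounded_ops_def dual_def pairing_apply ip_scale sum_distrib_left mult_ac)
qed

lemma pairing_finite_dimensional:
  assumes "orthonormal E"
  shows "finite_dimensional dual_scale (range (pairing E))"
proof -
  interpret D: vector_space dual_scale by (rule vector_space_dual_scale)
  have "pairing E x \<in> D.span (ip_functional ` E)" for x
    unfolding pairing_def by (intro D.span_sum D.span_scale D.span_base imageI)
  then show ?thesis
    unfolding finite_dimensional_def using assms
    by (intro exI[of _ "ip_functional ` E"]) (auto simp: orthonormal_def)
qed

text \<open>The form is nondegenerate on span E: taking the values f e themselves, unconjugated, as
  coefficients of a reproduces f there.\<close>

lemma pairing_interpolate: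
  assumes E: "orthonormal E" and f: "f \<in> dual scale"
  obtains a where "a \<in> span E" "\<And>x. x \<in> span E \<Longrightarrow> blinfun_apply (pairing E a) x = blinfun_apply f x"
proof -
  define a where "a = (\<Sum>e\<in>E. scale (blinfun_apply f e) e)"
  have "ip a e = blinfun_apply f e" if "e \<in> E" for e
  proof -
    have "ip a e = (\<Sum>d\<in>E. if d = e then blinfun_apply f e else 0)"
      unfolding a_def ip_sum using E that by (intro sum.cong) (auto simp: ip_scale orthonormal_def)
    then show ?thesis using E that by (simp add: orthonormal_def)
  qed
  then have a: "blinfun_apply (pairing E a) e = blinfun_apply f e" if "e \<in> E" for e
    using pairing_basis[OF E that] that by simp
  have "blinfun_apply (pairing E a) x = blinfun_apply f x" if "x \<in> span E" for x
  proof -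
    have "blinfun_apply (pairing E a) (proj E x) = blinfun_apply f (proj E x)"
      unfolding dual_expand_proj[OF f] dual_expand_proj[OF bounded_opsD(3)[OF pairing_bounded_ops]]
      using a by simp
    then show ?thesis using proj_eq_self_iff[OF E] that by metis
  qed
  moreover have "a \<in> span E" unfolding a_def by (intro span_sum span_scale span_base)
  ultimately show thesis using that by blast
qed

end

text \<open>Injectivity tests each equation on the kernel that annihilates its off-diagonal term.
  Surjectivity first matches f and h on the kernels, after which the annihilator descriptions of the
  two ranges supply the rest.\<close>

lemma fredholm_bordering:
  fixes s :: "'k::{real_normed_field, euclidean_space} \<Rightarrow> 'a::{real_inner, banach} \<Rightarrow> 'a"
    and r :: "'k \<Rightarrow> 'b::{real_inner, banach} \<Rightarrow> 'b"
  assumes s: "hilbert_space s ip" and r: "hilbert_space r ip'"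
    and A: "fredholm s dual_scale (dual r) A"
  obtains Q S where
    "Q \<in> bounded_ops s dual_scale (dual s)" "finite_dimensional dual_scale (range Q)"
    "S \<in> bounded_ops r dual_scale (dual r)" "finite_dimensional dual_scale (range S)"
    "\<And>x y. Q x + adjoint_op A y = 0 \<Longrightarrow> A x + S y = 0 \<Longrightarrow> x = 0 \<and> y = 0"
    "\<And>f h. f \<in> dual s \<Longrightarrow> h \<in> dual r \<Longrightarrow> \<exists>x y. Q x + adjoint_op A y = f \<and> A x + S y = h"
proof -
  interpret s: hilbert_space s ip by (rule s)
  interpret r: hilbert_space r ip' by (rule r)
  interpret D: vector_space dual_scale by (rule vector_space_dual_scale)
  have A': "A \<in> bounded_ops s dual_scale (dual r)" "finite_dimensional s (ker A)" "closed (range A)"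
    "finite_codim dual_scale (dual r) (range A)"
    using A by (auto simp: fredholm_def)
  note Aadj = adjoint_op_bounded_ops[OF A'(1)]
  note app = adjoint_op_apply[OF bounded_opsD(1)[OF A'(1)]]
  interpret A: Vector_Spaces.linear s dual_scale A
    by (rule bounded_ops_linear[OF A'(1) s.vector_space_axioms vector_space_dual_scale])
  interpret A': Vector_Spaces.linear r dual_scale "adjoint_op A"
    by (rule bounded_ops_linear[OF Aadj r.vector_space_axioms vector_space_dual_scale])
  obtain E where E: "s.orthonormal E" "s.span E = ker A"
    using s.finite_dimensional_subspace_orthonormal[OF _ A'(2)] A.subspace_kernel by (auto simp: ker_def)
  obtain E' where E': "r.orthonormal E'" "r.span E' = ker (adjoint_op A)"
    using r.finite_dimensional_subspace_orthonormal[OF _ finite_dimensional_ker_adjoint[OF r A'(1,4)]]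
      A'.subspace_kernel by (auto simp: ker_def)
  have kerA: "A x = 0" if "x \<in> s.span E" for x using that E(2) by (simp add: ker_def)
  have kerA': "adjoint_op A y = 0" if "y \<in> r.span E'" for y using that E'(2) by (simp add: ker_def)
  interpret Q: Vector_Spaces.linear s dual_scale "s.pairing E"
    by (rule bounded_ops_linear[OF s.pairing_bounded_ops s.vector_space_axioms vector_space_dual_scale])
  interpret S: Vector_Spaces.linear r dual_scale "r.pairing E'"
    by (rule bounded_ops_linear[OF r.pairing_bounded_ops r.vector_space_axioms vector_space_dual_scale])
  have Q0: "s.pairing E x = 0" if "s.proj E x = 0" for x
    using s.ip_proj_basis[OF E(1), of _ x] that by (simp add: s.pairing_def)
  have S0: "r.pairing E' y = 0" if "r.proj E' y = 0" for y
    using r.ip_proj_basis[OF E'(1), of _ y] that by (simp add: r.pairing_def)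
  show thesis
  proof (rule that)
    fix x y assume xy: "s.pairing E x + adjoint_op A y = 0" "A x + r.pairing E' y = 0"
    \<comment> \<open>Testing the first equation on e in ker A removes the adjoint term and leaves x
      orthogonal to ker A.\<close>
    have "ip x e = 0" if e: "e \<in> E" for e
    proof -
      have "blinfun_apply (s.pairing E x + adjoint_op A y) e = ip x e"
        using kerA[OF s.span_base[OF e]] s.pairing_basis[OF E(1) e]
        by (simp add: blinfun.add_left app)
      then show ?thesis using xy(1) by simp
    qed
    then have px: "s.proj E x = 0" by (simp add: s.proj_def)
    have "ip' y e = 0" if e: "e \<in> E'" for e
    proof -
      have "blinfun_apply (A x) e = 0" using kerA'[OF r.span_base[OF e]] app[of e x] by simp
      then have "blinfun_apply (A x + r.pairing E' y) e = ip' y e"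
        using r.pairing_basis[OF E'(1) e] by (simp add: blinfun.add_left)
      then show ?thesis using xy(2) by simp
    qed
    then have py: "r.proj E' y = 0" by (simp add: r.proj_def)
    \<comment> \<open>Orthogonality to the kernels makes both corrections vanish, so x and y also
      lie in those kernels.\<close>
    have "x \<in> s.span E" "y \<in> r.span E'"
      using xy Q0[OF px] S0[OF py] E(2) E'(2) by (auto simp: ker_def)
    then show "x = 0 \<and> y = 0"
      using px py s.proj_eq_self_iff[OF E(1)] r.proj_eq_self_iff[OF E'(1)] by metis
  next
    fix f h assume f: "f \<in> dual s" and h: "h \<in> dual r"
    obtain a where a: "a \<in> s.span E"
        "\<And>x. x \<in> s.span E \<Longrightarrow> blinfun_apply (s.pairing E a) x = blinfun_apply f x"
      using s.pairing_interpolate[OF E(1) f] by blast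
    obtain b where b: "b \<in> r.span E'"
        "\<And>y. y \<in> r.span E' \<Longrightarrow> blinfun_apply (r.pairing E' b) y = blinfun_apply h y"
      using r.pairing_interpolate[OF E'(1) h] by blast
    have "f - s.pairing E a \<in> dual s"
      using f bounded_opsD(3)[OF s.pairing_bounded_ops] D.subspace_diff[OF subspace_dual] by blast
    then have "f - s.pairing E a \<in> range (adjoint_op A)"
      by (rule range_adjoint_eq_annihilator[OF s r A'(1,3)])
        (use a(2) E(2) in \<open>auto simp: ker_def blinfun.diff_left\<close>)
    then obtain y where y: "adjoint_op A y = f - s.pairing E a" by auto
    have "h - r.pairing E' b \<in> dual r"
      using h bounded_opsD(3)[OF r.pairing_bounded_ops] D.subspace_diff[OF subspace_dual] by blast
    then have "h - r.pairing E' b \<in> range A"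
      by (rule range_eq_annihilator[OF s r A'(1,3)])
        (use b(2) E'(2) in \<open>auto simp: ker_def blinfun.diff_left\<close>)
    then obtain x where x: "A x = h - r.pairing E' b" by auto
    \<comment> \<open>Preimages are free up to kernels: exchanging the kernel parts of x and y for a
      and b leaves A x and the adjoint term unchanged and gives the corrections their prescribed
      values.\<close>
    have "s.proj E (x - s.proj E x) = 0"
      using s.ip_diff_proj[OF E(1) s.span_base, THEN s.ip_eq_0_commute] by (simp add: s.proj_def[of E "x - s.proj E x"])
    then have "s.pairing E (x - s.proj E x + a) = s.pairing E a" using Q0 by (simp add: Q.add)
    moreover have "r.proj E' (y - r.proj E' y) = 0"
      using r.ip_diff_proj[OF E'(1) r.span_base, THEN r.ip_eq_0_commute] by (simp add: r.proj_def[of E' "y - r.proj E' y"])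
    then have "r.pairing E' (y - r.proj E' y + b) = r.pairing E' b" using S0 by (simp add: S.add)
    moreover have "A (x - s.proj E x + a) = A x"
      using kerA[OF a(1)] kerA[OF s.proj_in_span] by (simp add: A.add A.diff)
    moreover have "adjoint_op A (y - r.proj E' y + b) = adjoint_op A y"
      using kerA'[OF b(1)] kerA'[OF r.proj_in_span] by (simp add: A'.add A'.diff)
    ultimately show "\<exists>x y. s.pairing E x + adjoint_op A y = f \<and> A x + r.pairing E' y = h"
      using x y by (intro exI[of _ "x - s.proj E x + a"] exI[of _ "y - r.proj E' y + b"]) simp
  qed (use s.pairing_bounded_ops r.pairing_bounded_ops s.pairing_finite_dimensional[OF E(1)]
      r.pairing_finite_dimensional[OF E'(1)] in auto)
qed

section \<open>The block operators\<close>

lemma bounded_ops_fst: "fst \<in> bounded_ops (prod_scale s t) s UNIV"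
  and bounded_ops_snd: "snd \<in> bounded_ops (prod_scale s t) t UNIV"
  by (simp_all add: bounded_ops_def prod_scale_def bounded_linear_fst bounded_linear_snd)

lemma finite_rank_approximable_zero:
  assumes "vector_space t" "module.subspace t W"
  shows "finite_rank_approximable s t W (\<lambda>x. 0)"
proof -
  interpret vector_space t by fact
  show ?thesis
    using assms(2)
    by (intro finite_rank_approximable_finite_rank)
      (auto simp: bounded_ops_def subspace_0 finite_dimensional_def intro!: exI[of _ "{}"])
qed

text \<open>Block elimination: the first equation yields x from y through D^-1, and the second
  becomes P D^-1 P^* y = P D^-1 f - h, which the Schur complement solves.\<close>

lemma saddle_point_bijective:
  assumes s3: "hilbert_space s3 ip3" and s4: "hilbert_space s4 ip4"
    and P: "P \<in> bounded_ops s3 dual_scale (dual s4)"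
    and D: "isomorphism_op s3 dual_scale (dual s3) D"
    and M: "isomorphism_op s4 dual_scale (dual s4) (\<lambda>y. P (inv D (adjoint_op P y)))"
  shows "D x + adjoint_op P y = 0 \<Longrightarrow> P x = 0 \<Longrightarrow> x = 0 \<and> y = 0"
    and "f \<in> dual s3 \<Longrightarrow> h \<in> dual s4 \<Longrightarrow> \<exists>x y. D x + adjoint_op P y = f \<and> P x = h"
proof -
  interpret V: vector_space dual_scale by (rule vector_space_dual_scale)
  have D': "D \<in> bounded_ops s3 dual_scale (dual s3)" "inj D" "range D = dual s3"
    using D by (auto simp: isomorphism_op_def bij_betw_def)
  have M': "inj (\<lambda>y. P (inv D (adjoint_op P y)))" "range (\<lambda>y. P (inv D (adjoint_op P y))) = dual s4"
    using M by (auto simp: isomorphism_op_def bij_betw_def)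
  note P' = adjoint_op_bounded_ops[OF P]
  interpret D: bounded_linear D using bounded_opsD D' by blast
  interpret P: bounded_linear P using bounded_opsD P by blast
  interpret P': bounded_linear "adjoint_op P" using bounded_opsD P' by blast
  have inv_D: "inv D (D x) = x" for x using D'(2) by simp
  have D_inv: "D (inv D w) = w" if "w \<in> dual s3" for w using that D'(3) by (simp add: f_inv_into_f)
  have inv_add: "inv D (v + w) = inv D v + inv D w" if "v \<in> dual s3" "w \<in> dual s3" for v w
    by (metis D.add D_inv inv_D that)
  have inv_D0: "inv D 0 = 0" by (metis D.zero inv_D)
  { assume "D x + adjoint_op P y = 0" "P x = 0"
    then have "adjoint_op P y = D (- x)" by (simp add: D.neg eq_neg_iff_add_eq_0 add.commute)
    \<comment> \<open>Zero is written as the value of the Schur complement at 0, so that its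
      injectivity applies directly.\<close>
    then have "P (inv D (adjoint_op P y)) = P (inv D (adjoint_op P 0))"
      using \<open>P x = 0\<close> by (simp add: inv_D P.neg P'.zero inv_D0 P.zero)
    then have "y = 0" using injD[OF M'(1)] by blast
    moreover from this have "D x = D 0" using \<open>D x + _ = 0\<close> by (simp add: P'.zero D.zero)
    ultimately show "x = 0 \<and> y = 0" using injD[OF D'(2)] by blast }
  assume f: "f \<in> dual s3" and h: "h \<in> dual s4"
  have "P (inv D f) - h \<in> dual s4"
    using bounded_opsD(3)[OF P] h V.subspace_diff[OF subspace_dual] by blast
  then obtain y where y: "P (inv D f) - h = P (inv D (adjoint_op P y))"
    unfolding M'(2)[symmetric] by blast
  have Py: "adjoint_op P y \<in> dual s3" using bounded_opsD(3)[OF P'] .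
  then have w: "f - adjoint_op P y \<in> dual s3"
    using f V.subspace_diff[OF subspace_dual] by blast
  have "inv D f = inv D (f - adjoint_op P y) + inv D (adjoint_op P y)"
    using inv_add[OF w Py] by simp
  then have "P (inv D (f - adjoint_op P y)) = h"
    using y P.add[of "inv D (f - adjoint_op P y)" "inv D (adjoint_op P y)"] by (simp add: algebra_simps)
  then show "\<exists>x y. D x + adjoint_op P y = f \<and> P x = h"
    using D_inv[OF w] by (intro exI[of _ "inv D (f - adjoint_op P y)"] exI[of _ y]) simp
qed

lemma reduced_block_op_fredholm:
  fixes s1 :: "'k::{real_normed_field, euclidean_space} \<Rightarrow> 'a::{real_inner, banach} \<Rightarrow> 'a"
    and s2 :: "'k \<Rightarrow> 'b::{real_inner, banach} \<Rightarrow> 'b"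
  assumes s1: "hilbert_space s1 ip1" and s2: "hilbert_space s2 ip2"
    and A: "fredholm s1 dual_scale (dual s2) A"
    and L: "compact_op s1 dual_scale (dual s1) L"
  defines "s \<equiv> prod_scale s1 s2"
    and "t \<equiv> prod_scale dual_scale dual_scale"
    and "W \<equiv> dual s1 \<times> dual s2"
  shows "fredholm s t W (reduced_block_op L A) \<and> fredholm_index s t W (reduced_block_op L A) = 0"
proof -
  interpret s1: hilbert_space s1 ip1 by (rule s1)
  interpret s2: hilbert_space s2 ip2 by (rule s2)
  note vd = vector_space_dual_scale
  have A': "A \<in> bounded_ops s1 dual_scale (dual s2)" using A by (simp add: fredholm_def)
  obtain Q S where Q: "Q \<in> bounded_ops s1 dual_scale (dual s1)" "finite_dimensional dual_scale (range Q)"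
    and S: "S \<in> bounded_ops s2 dual_scale (dual s2)" "finite_dimensional dual_scale (range S)"
    and inj: "\<And>x y. Q x + adjoint_op A y = 0 \<Longrightarrow> A x + S y = 0 \<Longrightarrow> x = 0 \<and> y = 0"
    and surj: "\<And>f h. f \<in> dual s1 \<Longrightarrow> h \<in> dual s2 \<Longrightarrow> \<exists>x y. Q x + adjoint_op A y = f \<and> A x + S y = h"
    using fredholm_bordering[OF s1 s2 A] by blast
  note fstE = bounded_ops_compose[OF _ bounded_ops_fst[of s1 s2], folded s_def]
    and sndE = bounded_ops_compose[OF _ bounded_ops_snd[of s1 s2], folded s_def]
  \<comment> \<open>J is the bordered block; R takes the corrections back, which leaves L in the
    corner.\<close>
  define J where "J x = (Q (fst x) + adjoint_op A (snd x), A (fst x) + S (snd x))" for x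
  define R where "R x = (L (fst x) + - Q (fst x), - S (snd x))" for x :: "'a \<times> 'b"
  have J: "J \<in> bounded_ops s t W"
    unfolding J_def[abs_def] t_def W_def
    by (intro bounded_ops_Pair bounded_ops_add vd subspace_dual fstE[OF Q(1)] fstE[OF A']
        sndE[OF S(1)] sndE[OF adjoint_op_bounded_ops[OF A']])
  have J_diff: "J (x - y) = J x - J y" for x y
    by (intro linear_diff bounded_linear.linear bounded_opsD(1)[OF J])
  have "inj J"
  proof (rule injI)
    fix x y assume "J x = J y"
    then have "J (x - y) = 0" by (simp add: J_diff)
    then have "fst (x - y) = 0 \<and> snd (x - y) = 0" using inj[of "fst (x - y)" "snd (x - y)"] by (simp add: J_def zero_prod_def)
    then show "x = y" by (simp add: prod_eq_iff)
  qed
  moreover have "range J = W"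
  proof
    show "range J \<subseteq> W" using J by (auto simp: bounded_ops_def)
    show "W \<subseteq> range J"
    proof
      fix w assume "w \<in> W"
      then obtain x y where "Q x + adjoint_op A y = fst w" "A x + S y = snd w"
        using surj[of "fst w" "snd w"] by (auto simp: W_def)
      then have "w = J (x, y)" by (simp add: J_def)
      then show "w \<in> range J" by blast
    qed
  qed
  moreover have "finite_rank_approximable s t W R"
    unfolding R_def[abs_def] t_def W_def s_def
    by (intro finite_rank_approximable_Pair finite_rank_approximable_add finite_rank_approximable_minus
        vd subspace_dual
        finite_rank_approximable_compose[OF s1.compact_op_approximable[OF L] bounded_ops_fst]
        finite_rank_approximable_compose[OF finite_rank_approximable_finite_rank[OF Q] bounded_ops_fst]
        finite_rank_approximable_compose[OF finite_rank_approximable_finite_rank[OF S] bounded_ops_snd])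
  moreover have "vector_space t" "closed W"
    by (auto simp: t_def W_def intro!: vector_space_prod_scale vd closed_Times closed_dual)
  ultimately have "fredholm s t W (\<lambda>x. J x + R x) \<and> fredholm_index s t W (\<lambda>x. J x + R x) = 0"
    unfolding s_def by (intro fredholm_iso_plus_approximable[OF hilbert_space_prod[OF s1 s2] _ _ J[unfolded s_def]])
  moreover have "(\<lambda>x. J x + R x) = reduced_block_op L A"
    by (auto simp: fun_eq_iff J_def R_def reduced_block_op_def)
  ultimately show ?thesis by simp
qed

lemma block_op_fredholm:
  fixes s1 :: "'k::{real_normed_field, euclidean_space} \<Rightarrow> 'a::{real_inner, banach} \<Rightarrow> 'a"
    and s2 :: "'k \<Rightarrow> 'b::{real_inner, banach} \<Rightarrow> 'b"
    and s3 :: "'k \<Rightarrow> 'c::{real_inner, banach} \<Rightarrow> 'c"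
    and s4 :: "'k \<Rightarrow> 'd::{real_inner, banach} \<Rightarrow> 'd"
  assumes s1: "hilbert_space s1 ip1" and s2: "hilbert_space s2 ip2"
    and s3: "hilbert_space s3 ip3" and s4: "hilbert_space s4 ip4"
    and A: "fredholm s1 dual_scale (dual s2) A"
    and L: "compact_op s1 dual_scale (dual s1) L"
    and P: "P \<in> bounded_ops s3 dual_scale (dual s4)"
    and D: "isomorphism_op s3 dual_scale (dual s3) D"
    and M: "isomorphism_op s4 dual_scale (dual s4) (\<lambda>y. P (inv D (adjoint_op P y)))"
    and B: "compact_op s3 dual_scale (dual s2) B"
  defines "s \<equiv> prod_scale s1 (prod_scale s2 (prod_scale s3 s4))"
    and "t \<equiv> prod_scale dual_scale (prod_scale dual_scale (prod_scale dual_scale dual_scale))"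
    and "W \<equiv> dual s1 \<times> dual s2 \<times> dual s3 \<times> dual s4"
  shows "fredholm s t W (block_op L A B D P) \<and> fredholm_index s t W (block_op L A B D P) = 0"
proof -
  interpret s1: hilbert_space s1 ip1 by (rule s1)
  interpret s2: hilbert_space s2 ip2 by (rule s2)
  note vd = vector_space_dual_scale
  have A': "A \<in> bounded_ops s1 dual_scale (dual s2)" using A by (simp add: fredholm_def)
  have D': "D \<in> bounded_ops s3 dual_scale (dual s3)" using D by (simp add: isomorphism_op_def)
  obtain Q S where Q: "Q \<in> bounded_ops s1 dual_scale (dual s1)" "finite_dimensional dual_scale (range Q)"
    and S: "S \<in> bounded_ops s2 dual_scale (dual s2)" "finite_dimensional dual_scale (range S)"
    and inj: "\<And>x y. Q x + adjoint_op A y = 0 \<Longrightarrow> A x + S y = 0 \<Longrightarrow> x = 0 \<and> y = 0"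
    and surj: "\<And>f h. f \<in> dual s1 \<Longrightarrow> h \<in> dual s2 \<Longrightarrow> \<exists>x y. Q x + adjoint_op A y = f \<and> A x + S y = h"
    using fredholm_bordering[OF s1 s2 A] by blast
  note inj' = saddle_point_bijective(1)[OF s3 s4 P D M]
    and surj' = saddle_point_bijective(2)[OF s3 s4 P D M]
  define x1 x2 x3 x4 where "x1 = (\<lambda>x::'a \<times> 'b \<times> 'c \<times> 'd. fst x)" and "x2 = (\<lambda>x::'a \<times> 'b \<times> 'c \<times> 'd. fst (snd x))"
    and "x3 = (\<lambda>x::'a \<times> 'b \<times> 'c \<times> 'd. fst (snd (snd x)))" and "x4 = (\<lambda>x::'a \<times> 'b \<times> 'c \<times> 'd. snd (snd (snd x)))"
  note x_defs = x1_def x2_def x3_def x4_def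
  have x: "x1 \<in> bounded_ops s s1 UNIV" "x2 \<in> bounded_ops s s2 UNIV"
    "x3 \<in> bounded_ops s s3 UNIV" "x4 \<in> bounded_ops s s4 UNIV"
    unfolding x_defs s_def
    by (auto simp: bounded_ops_def prod_scale_def intro!: bounded_linear_intros)
  \<comment> \<open>Only B and its adjoint couple (x1, x2) with (x3, x4); with both moved to R, J
    splits into the bordered block and the saddle point block.\<close>
  define J where "J x = (Q (x1 x) + adjoint_op A (x2 x), A (x1 x) + S (x2 x),
    D (x3 x) + adjoint_op P (x4 x), P (x3 x))" for x
  define R where "R x = (L (x1 x) + - Q (x1 x), - S (x2 x) + - B (x3 x), - adjoint_op B (x2 x),
    0 :: 'd \<Rightarrow>\<^sub>L 'k)" for x
  have J: "J \<in> bounded_ops s t W"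
    unfolding J_def[abs_def] t_def W_def
    by (intro bounded_ops_Pair bounded_ops_add vd subspace_dual bounded_ops_compose[OF Q(1) x(1)]
        bounded_ops_compose[OF A' x(1)] bounded_ops_compose[OF S(1) x(2)]
        bounded_ops_compose[OF adjoint_op_bounded_ops[OF A'] x(2)] bounded_ops_compose[OF D' x(3)]
        bounded_ops_compose[OF P x(3)] bounded_ops_compose[OF adjoint_op_bounded_ops[OF P] x(4)])
  have J_diff: "J (x - y) = J x - J y" for x y
    by (intro linear_diff bounded_linear.linear bounded_opsD(1)[OF J])
  have "inj J"
  proof (rule injI)
    fix x y assume "J x = J y"
    then have "J (x - y) = 0" by (simp add: J_diff)
    then have "x1 (x - y) = 0 \<and> x2 (x - y) = 0" "x3 (x - y) = 0 \<and> x4 (x - y) = 0"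
      using inj[of "x1 (x - y)" "x2 (x - y)"] inj'[of "x3 (x - y)" "x4 (x - y)"]
      by (simp_all add: J_def zero_prod_def)
    then show "x = y" by (simp add: x_defs prod_eq_iff)
  qed
  moreover have "range J = W"
  proof
    show "range J \<subseteq> W" using J by (auto simp: bounded_ops_def)
    show "W \<subseteq> range J"
    proof
      fix w assume "w \<in> W"
      then obtain w1 w2 w3 w4 where w: "w = (w1, w2, w3, w4)" "w1 \<in> dual s1" "w2 \<in> dual s2"
        "w3 \<in> dual s3" "w4 \<in> dual s4" by (auto simp: W_def)
      obtain y1 y2 where "Q y1 + adjoint_op A y2 = w1" "A y1 + S y2 = w2" using surj w by blast
      moreover obtain y3 y4 where "D y3 + adjoint_op P y4 = w3" "P y3 = w4" using surj' w by blast
      ultimately have "w = J (y1, y2, y3, y4)" by (simp add: J_def x_defs w(1))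
      then show "w \<in> range J" by blast
    qed
  qed
  moreover have "finite_rank_approximable s t W R"
    unfolding R_def[abs_def] t_def W_def
    by (intro finite_rank_approximable_Pair finite_rank_approximable_add finite_rank_approximable_minus
        finite_rank_approximable_zero vd subspace_dual vector_space_prod_scale
        finite_rank_approximable_compose[OF s1.compact_op_approximable[OF L] x(1)]
        finite_rank_approximable_compose[OF finite_rank_approximable_finite_rank[OF Q] x(1)]
        finite_rank_approximable_compose[OF finite_rank_approximable_finite_rank[OF S] x(2)]
        finite_rank_approximable_compose[OF s2.compact_op_approximable[OF B] x(3)]
        finite_rank_approximable_compose[OF s2.compact_op_adjoint_approximable[OF B] x(2)])
  moreover have "vector_space t" "closed W"
    by (auto simp: t_def W_def intro!: vector_space_prod_scale vd closed_Times closed_dual)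
  moreover note hilbert_space_prod[OF s1 hilbert_space_prod[OF s2 hilbert_space_prod[OF s3 s4]], folded s_def]
  ultimately have "fredholm s t W (\<lambda>x. J x + R x) \<and> fredholm_index s t W (\<lambda>x. J x + R x) = 0"
    by (intro fredholm_iso_plus_approximable[OF _ _ _ J])
  moreover have "(\<lambda>x. J x + R x) = block_op L A B D P"
    by (auto simp: fun_eq_iff J_def R_def block_op_def x_defs)
  ultimately show ?thesis by simp
qed

text \<open>The data on the third and fourth space form an antecedent of the first conjunct alone,
  because the reduced operator lives on the first two spaces; its conjunct comes from the same
  bordering, not from specialising the large block.\<close>

theorem propositionA3:
  fixes s1 :: "'k::{real_normed_field, euclidean_space} \<Rightarrow> 'a::{real_inner, banach} \<Rightarrow> 'a"
    and s2 :: "'k \<Rightarrow> 'b::{real_inner, banach} \<Rightarrow> 'b"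
    and s3 :: "'k \<Rightarrow> 'c::{real_inner, banach} \<Rightarrow> 'c"
    and s4 :: "'k \<Rightarrow> 'd::{real_inner, banach} \<Rightarrow> 'd"
    and ip1 :: "'a \<Rightarrow> 'a \<Rightarrow> 'k" and ip2 :: "'b \<Rightarrow> 'b \<Rightarrow> 'k"
    and ip3 :: "'c \<Rightarrow> 'c \<Rightarrow> 'k" and ip4 :: "'d \<Rightarrow> 'd \<Rightarrow> 'k"
    and L :: "'a \<Rightarrow> ('a \<Rightarrow>\<^sub>L 'k)" and A :: "'a \<Rightarrow> ('b \<Rightarrow>\<^sub>L 'k)" and B :: "'c \<Rightarrow> ('b \<Rightarrow>\<^sub>L 'k)"
    and D :: "'c \<Rightarrow> ('c \<Rightarrow>\<^sub>L 'k)" and P :: "'c \<Rightarrow> ('d \<Rightarrow>\<^sub>L 'k)"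
  assumes "hilbert_space s1 ip1" and "hilbert_space s2 ip2"
    and "fredholm s1 dual_scale (dual s2) A"
    and "compact_op s1 dual_scale (dual s1) L"
  shows
    "(hilbert_space s3 ip3 \<and> hilbert_space s4 ip4 \<and>
      P \<in> bounded_ops s3 dual_scale (dual s4) \<and>
      isomorphism_op s3 dual_scale (dual s3) D \<and>
      isomorphism_op s4 dual_scale (dual s4) (\<lambda>y. P (inv D (adjoint_op P y))) \<and>
      compact_op s3 dual_scale (dual s2) B
      \<longrightarrow>
      (let s = prod_scale s1 (prod_scale s2 (prod_scale s3 s4));
           t = prod_scale dual_scale (prod_scale dual_scale (prod_scale dual_scale dual_scale));
           W = dual s1 \<times> dual s2 \<times> dual s3 \<times> dual s4
       in fredholm s t W (block_op L A B D P) \<and>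
          fredholm_index s t W (block_op L A B D P) = 0))
     \<and>
     (let s = prod_scale s1 s2;
          t = prod_scale dual_scale dual_scale;
          W = dual s1 \<times> dual s2
      in fredholm s t W (reduced_block_op L A) \<and>
         fredholm_index s t W (reduced_block_op L A) = 0)"
  using block_op_fredholm[OF assms(1,2) _ _ assms(3,4)] reduced_block_op_fredholm[OF assms]
  unfolding Let_def by blast

end
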